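(* Let $N_t, N_m, N_e$ be positive integers with $N_e < N_t$, put $n = N_t - N_e$, $m = \min(n, N_m)$ and $k = \max(n, N_m)$. Let $\mathbf{H}$ be an $N_m \times n$ random matrix with i.i.d. circularly symmetric complex Gaussian entries of zero mean and unit variance. Let $\eta > 0$, $g > 0$, $r_s > 0$, and set $R_s = r_s \ln(1+g\eta)$. Define $$P_{out}^{ZF} = \Pr\Big[\ln\det\Big(I_{N_m} + \tfrac{\eta}{n}\mathbf{H}\mathbf{H}^{\dagger}\Big) < R_s\Big].$$ Then for all positive coefficients $b_1,\dots,b_m$ satisfying $b_m \le b_{m-1} \le \dots \le b_1$ and $\sum_{l=1}^m b_l = r_s$, $$P_{out}^{ZF} \le \prod_{l=1}^{m}\Gamma_{inc}(\xi(r_s),k-l+1)\left(1-\prod_{l=1}^{m}\Big[1-\frac{\Gamma_{inc}(\xi(b_l),k-l+1)}{\Gamma_{inc}(\xi(r_s),k-l+1)}\Big]\right),$$ where $\xi(x) = \frac{n}{\eta}\big((1+g\eta)^x - 1\big)$.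
   Context: $\Gamma_{inc}$ denotes the regularized lower incomplete Gamma function: for $x \ge 0$ and a positive integer $a$, $\Gamma_{inc}(x,a) = \frac{1}{(a-1)!}\int_0^x t^{a-1}e^{-t}\,dt$. $\mathbf{H}^\dagger$ is the conjugate transpose. $P_{out}^{ZF}$ is the outage probability of the zero-forcing transmit scheme for the MIMO wiretap channel ($N_t$ transmit, $N_m$ legitimate-receiver, $N_e$ eavesdropper antennas), with SNR $\eta$, array gain $g$, and secrecy multiplexing gain $r_s$. *)

theory Defs
  imports "HOL-Probability.Probability" "Jordan_Normal_Form.Determinant"
begin

text \<open>Regularized lower incomplete Gamma function, for a positive integer a.\<close>
definition Gamma_inc :: "real \<Rightarrow> nat \<Rightarrow> real" where
  "Gamma_inc x a = integral {0..x} (\<lambda>t. t ^ (a - 1) * exp (- t)) / fact (a - 1)"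

text \<open>Circularly symmetric complex Gaussian, zero mean, unit variance:
  density exp(-|z|^2)/pi w.r.t. Lebesgue measure on the complex plane.\<close>
definition cgauss :: "complex measure" where
  "cgauss = density lborel (\<lambda>z. ennreal (exp (- (cmod z * cmod z)) / pi))"

definition gauss_mat_law :: "nat \<Rightarrow> nat \<Rightarrow> (nat \<times> nat \<Rightarrow> complex) measure" where
  "gauss_mat_law r c = PiM ({0..<r} \<times> {0..<c}) (\<lambda>_. cgauss)"

definition to_mat :: "nat \<Rightarrow> nat \<Rightarrow> (nat \<times> nat \<Rightarrow> complex) \<Rightarrow> complex mat" where
  "to_mat r c h = mat r c (\<lambda>(i,j). h (i,j))"

definition conj_transpose :: "complex mat \<Rightarrow> complex mat" where
  "conj_transpose A = mat (dim_col A) (dim_row A) (\<lambda>(i,j). cnj (A $$ (j,i)))"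

definition P_out_ZF :: "nat \<Rightarrow> nat \<Rightarrow> nat \<Rightarrow> real \<Rightarrow> real \<Rightarrow> real \<Rightarrow> real" where
  "P_out_ZF Nt Nm Ne \<eta> g rs =
    (let n = Nt - Ne; Rs = rs * ln (1 + g * \<eta>) in
     measure (gauss_mat_law Nm n)
       {h \<in> space (gauss_mat_law Nm n).
          ln (Re (det (1\<^sub>m Nm + complex_of_real (\<eta> / real n) \<cdot>\<^sub>m
              (to_mat Nm n h * conj_transpose (to_mat Nm n h))))) < Rs})"

definition xi :: "nat \<Rightarrow> real \<Rightarrow> real \<Rightarrow> real \<Rightarrow> real" where
  "xi n \<eta> g x = real n / \<eta> * ((1 + g * \<eta>) powr x - 1)"

end

theory Submission
  imports Defs
begin

text \<open>
  Write \<open>m = min n N\<^sub>m\<close>, \<open>k = max n N\<^sub>m\<close> and \<open>\<rho> = \<eta> / n\<close>. By Sylvester's identity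
  one may assume that the matrix \<open>u\<close> is \<open>m \<times> k\<close>. Condition on its last row \<open>v\<close>. A product of
  Givens rotations moves \<open>v\<close> to the last coordinate axis; it does not change \<open>u u\<^sup>*\<close> and preserves the
  law of the other Gaussian rows. After the rotation \<open>det (I + \<rho> u u\<^sup>*)\<close> is at least
  \<open>1 + \<rho> \<parallel>v\<parallel>\<^sup>2\<close> times the same determinant for the remaining \<open>(m - 1) \<times> (k - 1)\<close> block,
  and \<open>\<parallel>v\<parallel>\<^sup>2\<close> is Gamma distributed with shape \<open>k\<close>. Iterating, the determinant stochastically dominates
  \<open>\<Prod>l. 1 + \<rho> x\<^sub>l\<close> with independent \<open>x\<^sub>l\<close> of shape \<open>k - l + 1\<close>. If this product is below
  \<open>(1 + g \<eta>) powr r\<^sub>s\<close>, then every \<open>x\<^sub>l\<close> is below \<open>\<xi> r\<^sub>s\<close> and some \<open>x\<^sub>l\<close> is below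
  \<open>\<xi> b\<^sub>l\<close>; the bound is the probability of this event.
\<close>

section \<open>Determinants of Gram matrices\<close>

text \<open>Block elimination with the identity corner as pivot: no inverse occurs, so the Schur
  complement formula holds over any integral domain.\<close>

lemma det_four_block_mat_schur:
  fixes A :: "'a :: idom mat"
  assumes A: "A \<in> carrier_mat n n" and X: "X \<in> carrier_mat n m" and Y: "Y \<in> carrier_mat m n"
  shows "det (four_block_mat A X Y (1\<^sub>m m)) = det (A - X * Y)"
proof -
  let ?L = "four_block_mat (A - X * Y) X (0\<^sub>m m n) (1\<^sub>m m)"
  let ?R = "four_block_mat (1\<^sub>m n) (0\<^sub>m n m) Y (1\<^sub>m m)"
  have XY: "X * Y \<in> carrier_mat n n" using X Y by simp
  have AXY: "A - X * Y \<in> carrier_mat n n" using XY by (rule minus_carrier_mat)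
  have "?L * ?R = four_block_mat ((A - X * Y) * 1\<^sub>m n + X * Y) ((A - X * Y) * 0\<^sub>m n m + X * 1\<^sub>m m)
      (0\<^sub>m m n * 1\<^sub>m n + 1\<^sub>m m * Y) (0\<^sub>m m n * 0\<^sub>m n m + 1\<^sub>m m * 1\<^sub>m m)"
    by (rule mult_four_block_mat[OF AXY X _ _ _ _ Y]) auto
  also have "(A - X * Y) * 1\<^sub>m n + X * Y = A"
    using A X Y by (simp only: right_mult_one_mat[OF AXY]) (auto intro!: eq_matI)
  also have "(A - X * Y) * 0\<^sub>m n m + X * 1\<^sub>m m = X"
    using X by (simp add: right_mult_zero_mat[OF AXY])
  also have "0\<^sub>m m n * 1\<^sub>m n + 1\<^sub>m m * Y = Y" using Y by simp
  also have "0\<^sub>m m n * 0\<^sub>m n m + 1\<^sub>m m * 1\<^sub>m m = (1\<^sub>m m :: 'a mat)" by simp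
  finally have "four_block_mat A X Y (1\<^sub>m m) = ?L * ?R" ..
  moreover have "det (?L * ?R) = det ?L * det ?R"
    by (rule det_mult[of _ "n + m"]) (use AXY in auto)
  moreover have "det ?L = det (A - X * Y) * det (1\<^sub>m m)"
    by (rule det_four_block_mat_lower_left_zero[OF AXY X]) auto
  moreover have "det ?R = det (1\<^sub>m n) * det (1\<^sub>m m)"
    by (rule det_four_block_mat_upper_right_zero[OF _ _ Y]) auto
  ultimately show ?thesis by simp
qed

text \<open>One block matrix is eliminated in two ways: pivoting on its lower right identity gives
  the left side, pivoting on its upper left identity gives the right side.\<close>

lemma sylvester_det_identity:
  fixes X :: "'a :: idom mat"
  assumes X: "X \<in> carrier_mat n m" and Y: "Y \<in> carrier_mat m n"
  shows "det (1\<^sub>m n + X * Y) = det (1\<^sub>m m + Y * X)"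
proof -
  let ?L = "four_block_mat (1\<^sub>m n) (0\<^sub>m n m) Y (1\<^sub>m m)"
  let ?R = "four_block_mat (1\<^sub>m n) (- X) (0\<^sub>m m n) (1\<^sub>m m + Y * X)"
  have mX: "- X \<in> carrier_mat n m" using X by simp
  have YX: "1\<^sub>m m + Y * X \<in> carrier_mat m m" using X Y by simp
  have "?L * ?R = four_block_mat (1\<^sub>m n * 1\<^sub>m n + 0\<^sub>m n m * 0\<^sub>m m n) (1\<^sub>m n * (- X) + 0\<^sub>m n m * (1\<^sub>m m + Y * X))
      (Y * 1\<^sub>m n + 1\<^sub>m m * 0\<^sub>m m n) (Y * (- X) + 1\<^sub>m m * (1\<^sub>m m + Y * X))"
    by (rule mult_four_block_mat[OF _ _ Y _ _ mX _ YX]) auto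
  also have "1\<^sub>m n * 1\<^sub>m n + 0\<^sub>m n m * 0\<^sub>m m n = (1\<^sub>m n :: 'a mat)" by simp
  also have "1\<^sub>m n * (- X) + 0\<^sub>m n m * (1\<^sub>m m + Y * X) = - X"
    using mX by (simp add: left_mult_zero_mat[OF YX])
  also have "Y * 1\<^sub>m n + 1\<^sub>m m * 0\<^sub>m m n = Y" using Y by simp
  also have "Y * (- X) + 1\<^sub>m m * (1\<^sub>m m + Y * X) = 1\<^sub>m m"
    using X Y YX by (auto intro!: eq_matI)
  finally have "four_block_mat (1\<^sub>m n) (- X) Y (1\<^sub>m m) = ?L * ?R" ..
  moreover have "det (?L * ?R) = det ?L * det ?R"
    by (rule det_mult[of _ "n + m"]) (use YX in auto)
  moreover have "det ?L = det (1\<^sub>m n) * det (1\<^sub>m m)"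
    by (rule det_four_block_mat_upper_right_zero[OF _ _ Y]) auto
  moreover have "det ?R = det (1\<^sub>m n) * det (1\<^sub>m m + Y * X)"
    by (rule det_four_block_mat_lower_left_zero[OF _ mX _ YX]) auto
  moreover have "det (four_block_mat (1\<^sub>m n) (- X) Y (1\<^sub>m m)) = det (1\<^sub>m n - (- X) * Y)"
    by (rule det_four_block_mat_schur[OF _ mX Y]) simp
  moreover have "1\<^sub>m n - (- X) * Y = 1\<^sub>m n + X * Y"
    using X Y by (auto intro!: eq_matI)
  ultimately show ?thesis by simp
qed

text \<open>Rank-one updates are rewritten as borders because the determinant is then affine in the
  border column \<open>x\<close> and the corner \<open>c\<close>.\<close>

definition bordered_mat :: "nat \<Rightarrow> 'a mat \<Rightarrow> (nat \<Rightarrow> 'a) \<Rightarrow> (nat \<Rightarrow> 'a) \<Rightarrow> 'a \<Rightarrow> 'a mat" where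
  "bordered_mat n A x y c = mat (Suc n) (Suc n)
     (\<lambda>(i, j). if i < n then (if j < n then A $$ (i, j) else x i) else (if j < n then y j else c))"

lemma det_bordered_mat_one:
  fixes A :: "'a :: idom mat"
  assumes A: "A \<in> carrier_mat n n"
  shows "det (bordered_mat n A x y 1) = det (mat n n (\<lambda>(i, j). A $$ (i, j) - x i * y j))"
proof -
  let ?X = "mat n 1 (\<lambda>(i, j). x i)" and ?Y = "mat 1 n (\<lambda>(i, j). y j)"
  have "bordered_mat n A x y 1 = four_block_mat A ?X ?Y (1\<^sub>m 1)"
    using A by (auto simp: bordered_mat_def intro!: eq_matI)
  moreover have "det (four_block_mat A ?X ?Y (1\<^sub>m 1)) = det (A - ?X * ?Y)"
    by (rule det_four_block_mat_schur[OF A]) auto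
  moreover have "A - ?X * ?Y = mat n n (\<lambda>(i, j). A $$ (i, j) - x i * y j)"
    using A by (auto intro!: eq_matI simp: scalar_prod_def)
  ultimately show ?thesis by simp
qed

text \<open>Laplace expansion along the last column. The cofactors ignore that column, so one
  \<open>d\<close>, determined by \<open>A\<close> and \<open>y\<close>, serves every
  \<open>x\<close> and \<open>c\<close>.\<close>

lemma det_bordered_mat_linear:
  fixes A :: "'a :: idom mat"
  assumes A: "A \<in> carrier_mat n n"
  obtains d where "\<And>x c. det (bordered_mat n A x y c) = (\<Sum>i<n. x i * d i) + c * det A"
proof
  fix x c
  let ?M = "bordered_mat n A x y c" and ?Z = "bordered_mat n A (\<lambda>_. 0) y 0"
  have M: "?M \<in> carrier_mat (Suc n) (Suc n)" by (simp add: bordered_mat_def)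
  have cof: "cofactor ?M i n = cofactor ?Z i n" if "i < Suc n" for i
  proof -
    have "mat_delete ?M i n = mat_delete ?Z i n"
      using that by (intro eq_matI) (auto simp: mat_delete_def bordered_mat_def)
    then show ?thesis by (simp add: cofactor_def)
  qed
  have "mat_delete ?Z n n = A"
    using A by (auto intro!: eq_matI simp: mat_delete_def bordered_mat_def)
  then have last: "cofactor ?Z n n = det A"
    by (simp add: cofactor_def)
  have "det ?M = (\<Sum>i<Suc n. ?M $$ (i, n) * cofactor ?M i n)"
    by (rule laplace_expansion_column[OF M]) simp
  also have "\<dots> = (\<Sum>i<n. ?M $$ (i, n) * cofactor ?M i n) + ?M $$ (n, n) * cofactor ?M n n"
    by (rule sum.lessThan_Suc)
  also have "(\<Sum>i<n. ?M $$ (i, n) * cofactor ?M i n) = (\<Sum>i<n. x i * cofactor ?Z i n)"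
    using cof by (intro sum.cong) (auto simp: bordered_mat_def[of n A x])
  also have "?M $$ (n, n) * cofactor ?M n n = c * det A"
    using cof[of n] last by (simp add: bordered_mat_def[of n A x])
  finally show "det ?M = (\<Sum>i<n. x i * cofactor ?Z i n) + c * det A" .
qed

section \<open>Positivity and growth of Gram determinants\<close>

text \<open>This is \<open>I + \<rho> u u\<^sup>*\<close> for the leading \<open>m\<close> by
  \<open>k\<close> block of \<open>u\<close>. With \<open>u\<close> a function on index pairs,
  dropping a row or column only changes \<open>m\<close> or \<open>k\<close>.\<close>

definition gram :: "real \<Rightarrow> nat \<Rightarrow> nat \<Rightarrow> (nat \<times> nat \<Rightarrow> complex) \<Rightarrow> complex mat" where
  "gram \<rho> m k u = mat m m (\<lambda>(a, b). (if a = b then 1 else 0) +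
      of_real \<rho> * (\<Sum>j<k. u (a, j) * cnj (u (b, j))))"

lemma gram_carrier [simp]: "gram \<rho> m k u \<in> carrier_mat m m"
  by (simp add: gram_def)

lemma gram_cong:
  "(\<And>a j. a < m \<Longrightarrow> j < k \<Longrightarrow> u (a, j) = v (a, j)) \<Longrightarrow> gram \<rho> m k u = gram \<rho> m k v"
  by (auto simp: gram_def intro!: eq_matI)

text \<open>Leibniz's formula in this form yields both continuity in \<open>\<rho>\<close> and
  measurability in the entries.\<close>

lemma det_gram_expand:
  "det (gram \<rho> m k u) = (\<Sum>p | p permutes {0..<m}. signof p * (\<Prod>i = 0..<m.
     (if i = p i then 1 else 0) + of_real \<rho> * (\<Sum>j<k. u (i, j) * cnj (u (p i, j)))))"
  unfolding det_def'[OF gram_carrier]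
  by (intro sum.cong arg_cong2[where f = "(*)"] prod.cong refl) (auto simp: gram_def permutes_in_image)

text \<open>The matrix is Hermitian: conjugating its entries transposes it.\<close>

lemma det_gram_real: "det (gram \<rho> m k u) = of_real (Re (det (gram \<rho> m k u)))"
proof -
  let ?G = "gram \<rho> m k u"
  interpret cnj: comm_ring_hom cnj by unfold_locales auto
  have "cnj (det ?G) = det (map_mat cnj ?G)" by (rule cnj.hom_det[symmetric])
  also have "map_mat cnj ?G = transpose_mat ?G"
    by (auto intro!: eq_matI simp: gram_def mult.commute)
  also have "det \<dots> = det ?G" by (rule det_transpose[OF gram_carrier])
  finally show ?thesis by (metis Reals_cnj_iff of_real_Re)
qed

text \<open>For a kernel vector \<open>v\<close> of the Gram matrix \<open>G\<close>,
  \<open>0 = v\<^sup>* G v = |v|^2 + \<rho> |v\<^sup>* u|^2\<close>, which forces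
  \<open>v = 0\<close>.\<close>

lemma det_gram_nonzero:
  assumes "0 \<le> \<rho>"
  shows "det (gram \<rho> m k u) \<noteq> 0"
proof
  assume "det (gram \<rho> m k u) = 0"
  then obtain v where v: "v \<in> carrier_vec m" "v \<noteq> 0\<^sub>v m" "gram \<rho> m k u *\<^sub>v v = 0\<^sub>v m"
    using det_0_iff_vec_prod_zero_field[OF gram_carrier] by blast
  have row: "(\<Sum>b<m. gram \<rho> m k u $$ (a, b) * vec_index v b) = 0" if "a < m" for a
  proof -
    have "vec_index (gram \<rho> m k u *\<^sub>v v) a = 0" using v(3) that by simp
    then show ?thesis using that v(1)
      by (simp add: scalar_prod_def gram_def lessThan_atLeast0)
  qed
  \<comment> \<open>\<open>S\<close> is the row vector \<open>v\<^sup>* u\<close>, through which the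
    double sum over \<open>a\<close> and \<open>b\<close> factors.\<close>
  define S where "S j = (\<Sum>a<m. cnj (vec_index v a) * u (a, j))" for j
  have "0 = (\<Sum>a<m. cnj (vec_index v a) * (\<Sum>b<m. gram \<rho> m k u $$ (a, b) * vec_index v b))"
    using row by simp
  also have "\<dots> = (\<Sum>a<m. \<Sum>b<m. (if a = b then cnj (vec_index v a) * vec_index v b else 0)) +
      (\<Sum>a<m. \<Sum>b<m. \<Sum>j<k. of_real \<rho> * ((cnj (vec_index v a) * u (a, j)) * (cnj (u (b, j)) * vec_index v b)))"
    unfolding sum_distrib_left sum.distrib[symmetric]
    by (intro sum.cong refl) (auto simp: gram_def algebra_simps sum_distrib_left sum_distrib_right)
  also have "(\<Sum>a<m. \<Sum>b<m. (if a = b then cnj (vec_index v a) * vec_index v b else 0)) = (\<Sum>a<m. cnj (vec_index v a) * vec_index v a)"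
    by (intro sum.cong) (auto simp: sum.delta)
  also have "(\<Sum>a<m. \<Sum>b<m. \<Sum>j<k. of_real \<rho> * ((cnj (vec_index v a) * u (a, j)) * (cnj (u (b, j)) * vec_index v b))) =
      of_real \<rho> * (\<Sum>j<k. \<Sum>a<m. \<Sum>b<m. (cnj (vec_index v a) * u (a, j)) * (cnj (u (b, j)) * vec_index v b))"
    by (subst (2) sum.swap, subst sum.swap) (simp add: sum_distrib_left sum.swap[of _ "{..<k}"])
  also have "(\<Sum>j<k. \<Sum>a<m. \<Sum>b<m. (cnj (vec_index v a) * u (a, j)) * (cnj (u (b, j)) * vec_index v b)) = (\<Sum>j<k. S j * cnj (S j))"
    by (simp add: S_def sum_product mult.commute[of "cnj (u _)"])
  finally have "(\<Sum>a<m. cnj (vec_index v a) * vec_index v a) + of_real \<rho> * (\<Sum>j<k. S j * cnj (S j)) = 0" by simp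
  moreover have "cnj z * z = of_real ((cmod z)\<^sup>2)" "z * cnj z = of_real ((cmod z)\<^sup>2)" for z
    by (simp_all only: complex_norm_square mult.commute)
  ultimately have "of_real ((\<Sum>a<m. (cmod (vec_index v a))\<^sup>2) + \<rho> * (\<Sum>j<k. (cmod (S j))\<^sup>2)) = (0 :: complex)"
    by simp
  then have "(\<Sum>a<m. (cmod (vec_index v a))\<^sup>2) + \<rho> * (\<Sum>j<k. (cmod (S j))\<^sup>2) = 0"
    by (simp only: of_real_eq_0_iff)
  moreover have "0 \<le> \<rho> * (\<Sum>j<k. (cmod (S j))\<^sup>2)" using assms by (simp add: sum_nonneg)
  moreover have "0 \<le> (\<Sum>a<m. (cmod (vec_index v a))\<^sup>2)" by (simp add: sum_nonneg)
  ultimately have "(\<Sum>a<m. (cmod (vec_index v a))\<^sup>2) = 0" by linarith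
  then have "vec_index v a = 0" if "a < m" for a using that by (simp add: sum_nonneg_eq_0_iff)
  then have "v = 0\<^sub>v m" using v(1) by (auto intro!: eq_vecI)
  then show False using v(2) by simp
qed

text \<open>The determinant is real and never vanishes as \<open>\<rho>\<close> grows from \<open>0\<close>, where it equals \<open>1\<close>.\<close>

lemma det_gram_pos:
  assumes "0 \<le> \<rho>"
  shows "0 < Re (det (gram \<rho> m k u))"
proof (rule ccontr)
  define f where "f t = Re (det (gram t m k u))" for t
  assume "\<not> 0 < Re (det (gram \<rho> m k u))"
  then have "f \<rho> \<le> 0" by (simp add: f_def)
  moreover have "gram 0 m k u = 1\<^sub>m m" by (auto simp: gram_def intro!: eq_matI)
  then have "f 0 = 1" by (simp add: f_def)
  moreover have "continuous_on {0..\<rho>} f"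
    unfolding f_def det_gram_expand by (intro continuous_intros)
  ultimately obtain t where "0 \<le> t" "f t = 0"
    using IVT2'[of f \<rho> 0 0] assms by auto
  then show False
    using det_gram_nonzero[of t m k u] det_gram_real[of t m k u] by (simp add: f_def)
qed

text \<open>\<open>det (G + s a a\<^sup>*)\<close> is affine in \<open>s\<close> and positive for all \<open>s \<ge> 0\<close>, hence nondecreasing.\<close>

lemma det_gram_mono:
  assumes "0 \<le> \<rho>"
  shows "Re (det (gram \<rho> m k u)) \<le> Re (det (gram \<rho> m (Suc k) u))"
proof -
  let ?G = "gram \<rho> m k u"
  obtain d where d: "\<And>x c. det (bordered_mat m ?G x (\<lambda>j. of_real \<rho> * cnj (u (j, k))) c) = (\<Sum>i<m. x i * d i) + c * det ?G"
    using det_bordered_mat_linear[OF gram_carrier] by blast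
  define X where "X = (\<Sum>i<m. u (i, k) * d i)"
  \<comment> \<open>Scaling column \<open>k\<close> by \<open>sqrt s\<close> multiplies its rank-one
    contribution by \<open>s\<close>, so every point of the affine family is itself a Gram
    determinant and hence positive.\<close>
  define us where "us s = (\<lambda>(a, j). if j = k then of_real (sqrt s) * u (a, j) else u (a, j))" for s
  have det_s: "det (gram \<rho> m (Suc k) (us s)) = det ?G - of_real s * X" if "0 \<le> s" for s
  proof -
    have ss: "of_real (sqrt s) * of_real (sqrt s) = (of_real s :: complex)"
      using that by (simp flip: of_real_mult)
    have eq: "gram \<rho> m (Suc k) (us s) =
        mat m m (\<lambda>(i, j). ?G $$ (i, j) - (- (of_real s * u (i, k))) * (of_real \<rho> * cnj (u (j, k))))"
      by (intro eq_matI) (auto simp: gram_def us_def ss[symmetric] algebra_simps)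
    show ?thesis
      unfolding eq det_bordered_mat_one[OF gram_carrier, symmetric] d X_def
      by (simp add: sum_distrib_left sum_negf mult.assoc)
  qed
  have "us 1 = u" by (auto simp: us_def)
  then have 1: "det (gram \<rho> m (Suc k) u) = det ?G - X" using det_s[of 1] by simp
  have "Re X \<le> 0"
  proof (rule ccontr)
    assume "\<not> Re X \<le> 0"
    then have "0 < Re X" by simp
    \<comment> \<open>This value of \<open>s\<close> is the zero that the affine function would have
      if its slope were negative.\<close>
    then have s: "0 \<le> Re (det ?G) / Re X" using det_gram_pos[OF assms, of m k u] by simp
    have "0 < Re (det (gram \<rho> m (Suc k) (us (Re (det ?G) / Re X))))"
      by (rule det_gram_pos[OF assms])
    then show False using \<open>0 < Re X\<close> unfolding det_s[OF s] by simp
  qed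
  then show ?thesis using 1 by simp
qed

text \<open>The last row meets the others only in column \<open>k\<close>, so the matrix is a
  bordering of \<open>?G\<close> by multiples of that column. Evaluating the affine formula at this
  border and at the one whose Schur complement is \<open>?B\<close> eliminates the unknown
  \<open>X\<close>.\<close>

lemma det_gram_last_row_axis:
  assumes "\<And>j. j < k \<Longrightarrow> u (m, j) = 0"
  shows "det (gram \<rho> (Suc m) (Suc k) u) =
    det (gram \<rho> m (Suc k) u) + of_real (\<rho> * (cmod (u (m, k)))\<^sup>2) * det (gram \<rho> m k u)"
proof -
  define r where "r = u (m, k)"
  let ?G = "gram \<rho> m (Suc k) u" and ?B = "gram \<rho> m k u"
  let ?y = "\<lambda>j. of_real \<rho> * r * cnj (u (j, k))"
  obtain d where d: "\<And>x c. det (bordered_mat m ?G x ?y c) = (\<Sum>i<m. x i * d i) + c * det ?G"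
    using det_bordered_mat_linear[OF gram_carrier] by blast
  define X where "X = (\<Sum>i<m. u (i, k) * d i)"
  have rr: "r * cnj r = of_real ((cmod r)\<^sup>2)" by (simp only: complex_norm_square)
  have "gram \<rho> (Suc m) (Suc k) u =
      bordered_mat m ?G (\<lambda>i. of_real \<rho> * cnj r * u (i, k)) ?y (1 + of_real \<rho> * (r * cnj r))"
    using assms by (intro eq_matI) (auto simp: gram_def bordered_mat_def r_def less_Suc_eq)
  then have A: "det (gram \<rho> (Suc m) (Suc k) u) =
      of_real \<rho> * cnj r * X + (1 + of_real \<rho> * (r * cnj r)) * det ?G"
    by (simp only: d) (simp add: X_def sum_distrib_left mult.assoc)
  show ?thesis
  proof (cases "r = 0")
    case True
    then show ?thesis using A by (simp add: r_def)
  next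
    case False
    \<comment> \<open>The border \<open>u (i, k) / r\<close> is chosen so that the Schur complement
      subtracts exactly the contribution of column \<open>k\<close>.\<close>
    have "?B = mat m m (\<lambda>(i, j). ?G $$ (i, j) - (u (i, k) / r) * ?y j)"
      using False by (intro eq_matI) (auto simp: gram_def algebra_simps)
    then have "det ?B = det (bordered_mat m ?G (\<lambda>i. u (i, k) / r) ?y 1)"
      by (simp only: det_bordered_mat_one[OF gram_carrier])
    also have "\<dots> = X / r + det ?G"
      by (simp only: d) (simp add: X_def sum_divide_distrib)
    finally have X_eq: "X = r * (det ?B - det ?G)" using False by (simp add: field_simps)
    have "det (gram \<rho> (Suc m) (Suc k) u) = det ?G + of_real \<rho> * (r * cnj r) * det ?B"
      unfolding A X_eq by (simp add: algebra_simps)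
    then show ?thesis unfolding rr by (simp add: r_def)
  qed
qed

text \<open>Monotonicity discards column \<open>k\<close> of the other rows. This is where equality
  is lost, and what remains is independent of that column.\<close>

lemma det_gram_last_row_axis_ge:
  assumes "0 \<le> \<rho>" "\<And>j. j < k \<Longrightarrow> u (m, j) = 0"
  shows "(1 + \<rho> * (cmod (u (m, k)))\<^sup>2) * Re (det (gram \<rho> m k u)) \<le> Re (det (gram \<rho> (Suc m) (Suc k) u))"
  using det_gram_mono[OF assms(1), of m k u]
    det_gram_last_row_axis[of k u m \<rho>, OF assms(2)]
  by (simp add: algebra_simps)

lemma gram_eq_one_plus:
  "1\<^sub>m r + complex_of_real \<rho> \<cdot>\<^sub>m (to_mat r c h * conj_transpose (to_mat r c h)) = gram \<rho> r c h"
  by (auto intro!: eq_matI simp: gram_def to_mat_def conj_transpose_def scalar_prod_def lessThan_atLeast0)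

text \<open>Sylvester's identity exchanges \<open>h h\<^sup>*\<close> for
  \<open>h\<^sup>* h\<close>, which gives the transpose of the Gram matrix of the transposed
  array.\<close>

lemma det_gram_swap: "det (gram \<rho> r c h) = det (gram \<rho> c r (\<lambda>(i, j). h (j, i)))"
proof -
  let ?X = "complex_of_real \<rho> \<cdot>\<^sub>m to_mat r c h" and ?Y = "conj_transpose (to_mat r c h)"
  have X: "?X \<in> carrier_mat r c" and Y: "?Y \<in> carrier_mat c r"
    by (simp_all add: to_mat_def conj_transpose_def)
  have "gram \<rho> r c h = 1\<^sub>m r + ?X * ?Y"
    by (auto intro!: eq_matI simp: gram_def to_mat_def conj_transpose_def scalar_prod_def
        lessThan_atLeast0 sum_distrib_left mult.assoc)
  then have "det (gram \<rho> r c h) = det (1\<^sub>m c + ?Y * ?X)"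
    using sylvester_det_identity[OF X Y] by simp
  also have "1\<^sub>m c + ?Y * ?X = transpose_mat (gram \<rho> c r (\<lambda>(i, j). h (j, i)))"
    by (auto intro!: eq_matI simp: gram_def to_mat_def conj_transpose_def scalar_prod_def
        lessThan_atLeast0 sum_distrib_left mult_ac)
  also have "det \<dots> = det (gram \<rho> c r (\<lambda>(i, j). h (j, i)))"
    by (rule det_transpose[OF gram_carrier])
  finally show ?thesis .
qed

section \<open>The complex Gaussian law\<close>

lemma sets_cgauss [simp, measurable_cong]: "sets cgauss = sets borel"
  by (simp add: cgauss_def)

lemma space_cgauss [simp]: "space cgauss = UNIV"
  by (simp add: cgauss_def)

text \<open>The preimage of \<open>{..a}\<close> is a disc of radius \<open>sqrt a\<close> and area
  \<open>pi * a\<close>, or null for negative \<open>a\<close>; half-lines form a generating family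
  stable under intersection.\<close>

lemma distr_lborel_cmod_sq:
  "distr lborel borel (\<lambda>z :: complex. cmod z * cmod z) = density lborel (\<lambda>t. ennreal pi * indicator {0..} t)"
  (is "?M = ?N")
proof (rule measure_eqI_generator_eq)
  let ?E = "range (\<lambda>a :: real. {..a})"
  show "Int_stable ?E"
    by (auto simp: Int_stable_def)
  have "sets borel = sigma_sets UNIV ?E"
    by (subst borel_eq_atMost) (rule sets_measure_of, simp)
  then show "sets ?M = sigma_sets UNIV ?E" "sets ?N = sigma_sets UNIV ?E"
    by (simp_all only: sets_distr sets_density sets_lborel)
  show "range (\<lambda>i :: nat. {..real i}) \<subseteq> ?E" "(\<Union>i :: nat. {..real i}) = UNIV"
    by (auto simp: real_arch_simple)
  have eq: "emeasure ?M {..a} = emeasure ?N {..a}" "emeasure ?M {..a} \<noteq> \<infinity>" for a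
  proof -
    have "emeasure ?M {..a} = emeasure lborel {z :: complex. cmod z * cmod z \<le> a}"
      by (subst emeasure_distr) (auto intro!: arg_cong[where f = "emeasure lborel"])
    also have "\<dots> = ennreal (pi * max 0 a)"
    proof (cases "0 \<le> a")
      case True
      have "cmod z * cmod z \<le> a \<longleftrightarrow> cmod z \<le> sqrt a" for z
        using real_le_rsqrt[of "cmod z" a] sqrt_ge_absD[of "cmod z" a]
        by (auto simp: power2_eq_square)
      then have "{z :: complex. cmod z * cmod z \<le> a} = cball 0 (sqrt a)"
        by (simp only: cball_def dist_0_norm)
      then show ?thesis
        using True emeasure_cball[of "sqrt a" "0 :: complex"]
        by (simp add: unit_ball_vol_2 max_def)
    next
      case False
      then have "\<not> cmod z * cmod z \<le> a" for z
        using zero_le_square[of "cmod z"] by linarith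
      then have "{z :: complex. cmod z * cmod z \<le> a} = {}" by simp
      then show ?thesis using False by simp
    qed
    finally have 1: "emeasure ?M {..a} = ennreal (pi * max 0 a)" .
    have "emeasure ?N {..a} = (\<integral>\<^sup>+t. ennreal pi * indicator {0..a} t \<partial>lborel)"
      by (simp add: emeasure_density) (auto intro!: nn_integral_cong simp: indicator_def)
    also have "\<dots> = ennreal pi * ennreal (max 0 a)"
      by (subst nn_integral_cmult) (auto simp: emeasure_lborel_Icc_eq max_def)
    finally show "emeasure ?M {..a} = emeasure ?N {..a}"
      using 1 by (simp add: ennreal_mult)
    show "emeasure ?M {..a} \<noteq> \<infinity>" unfolding 1 by simp
  qed
  show "emeasure ?M X = emeasure ?N X" if "X \<in> ?E" for X
    using that eq by blast
  show "emeasure ?M {..real i} \<noteq> \<infinity>" for i by (rule eq)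
qed auto

text \<open>The Gaussian density depends on \<open>z\<close> only through its squared modulus, so it
  passes to the image measure, where the factors \<open>pi\<close> cancel. The index of
  \<open>erlang_density\<close> is the shape minus one.\<close>

lemma distr_cgauss_cmod_sq:
  "distr cgauss borel (\<lambda>z. cmod z * cmod z) = density lborel (erlang_density 0 1)"
proof -
  have "distr cgauss borel (\<lambda>z. cmod z * cmod z) =
      density (distr lborel borel (\<lambda>z :: complex. cmod z * cmod z)) (\<lambda>t. ennreal (exp (- t) / pi))"
    unfolding cgauss_def by (rule density_distr[symmetric]) auto
  also have "\<dots> = density lborel (\<lambda>t. ennreal pi * indicator {0..} t * ennreal (exp (- t) / pi))"
    unfolding distr_lborel_cmod_sq by (rule density_density_eq) auto
  also have "\<dots> = density lborel (erlang_density 0 1)"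
    by (rule density_cong) (auto simp: erlang_density_def indicator_def ennreal_mult[symmetric])
  finally show ?thesis .
qed

lemma prob_space_cgauss: "prob_space cgauss"
proof
  have "emeasure cgauss (space cgauss) = emeasure (distr cgauss borel (\<lambda>z. cmod z * cmod z)) UNIV"
    by (subst emeasure_distr) auto
  also have "\<dots> = 1"
    unfolding distr_cgauss_cmod_sq
    using prob_space.emeasure_space_1[OF prob_space_erlang_density[of 1 0]] by simp
  finally show "emeasure cgauss (space cgauss) = 1" .
qed

interpretation cgauss: prob_space cgauss by (rule prob_space_cgauss)

interpretation PiM_cgauss: product_prob_space "\<lambda>_. cgauss" UNIV
  by unfold_locales

lemma indep_vars_PiM_coordinates:
  assumes "I \<noteq> {}" and M: "\<And>i. i \<in> I \<Longrightarrow> prob_space (M i)"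
  shows "prob_space.indep_vars (PiM I M) M (\<lambda>i \<omega>. \<omega> i) I"
proof -
  interpret prob_space "PiM I M" by (rule prob_space_PiM) (rule M)
  have "distr (PiM I M) (PiM I M) (\<lambda>x. \<lambda>i\<in>I. x i) = distr (PiM I M) (PiM I M) (\<lambda>x. x)"
    by (rule distr_cong) (auto simp: space_PiM)
  also have "\<dots> = PiM I M" by (rule distr_id)
  also have "\<dots> = PiM I (\<lambda>i. distr (PiM I M) (M i) (\<lambda>\<omega>. \<omega> i))"
    by (rule PiM_cong) (auto simp: distr_PiM_component M)
  finally show ?thesis
    by (subst indep_vars_iff_distr_eq_PiM') (use assms in auto)
qed

text \<open>A sum of \<open>card I\<close> independent exponential variables has a Gamma law of
  shape \<open>card I\<close>.\<close>

lemma distr_PiM_cgauss_sum_cmod_sq: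
  assumes "finite I" "I \<noteq> {}"
  shows "distr (PiM I (\<lambda>_. cgauss)) borel (\<lambda>v. \<Sum>i\<in>I. (cmod (v i))\<^sup>2) =
    density lborel (erlang_density (card I - 1) 1)"
proof -
  let ?P = "PiM I (\<lambda>_. cgauss)"
  interpret P: prob_space ?P by (rule prob_space_PiM) (rule prob_space_cgauss)
  have "P.indep_vars (\<lambda>_. cgauss) (\<lambda>i \<omega>. \<omega> i) I"
    by (rule indep_vars_PiM_coordinates) (use assms prob_space_cgauss in auto)
  then have indep: "P.indep_vars (\<lambda>_. borel) (\<lambda>i \<omega>. cmod (\<omega> i) * cmod (\<omega> i)) I"
    by (rule P.indep_vars_compose2) measurable
  have "distributed ?P lborel (\<lambda>\<omega>. cmod (\<omega> i) * cmod (\<omega> i)) (erlang_density 0 1)" if i: "i \<in> I" for i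
  proof -
    have "distr ?P lborel (\<lambda>\<omega>. cmod (\<omega> i) * cmod (\<omega> i)) =
        distr (distr ?P cgauss (\<lambda>\<omega>. \<omega> i)) borel (\<lambda>z. cmod z * cmod z)"
      using i by (subst distr_distr) (auto simp: comp_def intro!: distr_cong)
    also have "distr ?P cgauss (\<lambda>\<omega>. \<omega> i) = cgauss"
      by (rule distr_PiM_component[where M = "\<lambda>_. cgauss"]) (use i prob_space_cgauss in auto)
    finally show ?thesis using i
      unfolding distributed_def by (simp add: distr_cgauss_cmod_sq)
  qed
  then have "distributed ?P lborel (\<lambda>\<omega>. \<Sum>i\<in>I. cmod (\<omega> i) * cmod (\<omega> i)) (erlang_density (card I - 1) 1)"
    by (intro P.exponential_distributed_sum assms indep) auto
  then show ?thesis
    by (simp add: distributed_def power2_eq_square cong: distr_cong)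
qed

section \<open>Shears and Givens rotations of a Gaussian pair\<close>

lemma nn_integral_lborel_translate:
  fixes f :: "'a :: euclidean_space \<Rightarrow> ennreal"
  assumes [measurable]: "f \<in> borel_measurable borel"
  shows "(\<integral>\<^sup>+x. f (x + c) \<partial>lborel) = (\<integral>\<^sup>+x. f x \<partial>lborel)"
proof -
  have "(\<integral>\<^sup>+x. f x \<partial>lborel) = (\<integral>\<^sup>+x. f x \<partial>distr lborel borel ((+) c))"
    by (simp add: lborel_distr_plus)
  also have "\<dots> = (\<integral>\<^sup>+x. f (c + x) \<partial>lborel)" by (rule nn_integral_distr) auto
  finally show ?thesis by (simp add: add.commute)
qed

text \<open>By Tonelli the moving coordinate is integrated first; with the other one fixed, the
  shear is a translation.\<close>

lemma nn_integral_shear: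
  fixes f :: "complex \<times> complex \<Rightarrow> ennreal"
  assumes [measurable]: "f \<in> borel_measurable (borel \<Otimes>\<^sub>M borel)"
  shows "(\<integral>\<^sup>+p. f (fst p + a * snd p, snd p) \<partial>(lborel \<Otimes>\<^sub>M lborel)) = (\<integral>\<^sup>+p. f p \<partial>(lborel \<Otimes>\<^sub>M lborel))"
    and "(\<integral>\<^sup>+p. f (fst p, snd p + a * fst p) \<partial>(lborel \<Otimes>\<^sub>M lborel)) = (\<integral>\<^sup>+p. f p \<partial>(lborel \<Otimes>\<^sub>M lborel))"
proof -
  have "(\<integral>\<^sup>+p. f (fst p + a * snd p, snd p) \<partial>(lborel \<Otimes>\<^sub>M lborel)) =
      (\<integral>\<^sup>+y. \<integral>\<^sup>+x. f (x + a * y, y) \<partial>lborel \<partial>lborel)"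
    by (subst lborel_pair.nn_integral_snd[symmetric]) auto
  also have "\<dots> = (\<integral>\<^sup>+y. \<integral>\<^sup>+x. f (x, y) \<partial>lborel \<partial>lborel)"
    by (intro nn_integral_cong nn_integral_lborel_translate[where f = "\<lambda>x. f (x, _)"]) measurable
  also have "\<dots> = (\<integral>\<^sup>+p. f p \<partial>(lborel \<Otimes>\<^sub>M lborel))"
    by (rule lborel_pair.nn_integral_snd) auto
  finally show "(\<integral>\<^sup>+p. f (fst p + a * snd p, snd p) \<partial>(lborel \<Otimes>\<^sub>M lborel)) = (\<integral>\<^sup>+p. f p \<partial>(lborel \<Otimes>\<^sub>M lborel))" .
  have "(\<integral>\<^sup>+p. f (fst p, snd p + a * fst p) \<partial>(lborel \<Otimes>\<^sub>M lborel)) =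
      (\<integral>\<^sup>+x. \<integral>\<^sup>+y. f (x, y + a * x) \<partial>lborel \<partial>lborel)"
    by (subst lborel.nn_integral_fst[symmetric]) auto
  also have "\<dots> = (\<integral>\<^sup>+x. \<integral>\<^sup>+y. f (x, y) \<partial>lborel \<partial>lborel)"
    by (intro nn_integral_cong nn_integral_lborel_translate[where f = "\<lambda>y. f (_, y)"]) measurable
  also have "\<dots> = (\<integral>\<^sup>+p. f p \<partial>(lborel \<Otimes>\<^sub>M lborel))"
    by (rule lborel.nn_integral_fst) auto
  finally show "(\<integral>\<^sup>+p. f (fst p, snd p + a * fst p) \<partial>(lborel \<Otimes>\<^sub>M lborel)) = (\<integral>\<^sup>+p. f p \<partial>(lborel \<Otimes>\<^sub>M lborel))" .
qed

text \<open>A Givens rotation is a product of three shears; for \<open>s = 0\<close> (hence \<open>c = 1\<close>) the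
  coefficient \<open>(1 - c) / cnj s\<close> is \<open>0\<close>, as it should be.\<close>

lemma nn_integral_lborel_givens:
  fixes f :: "complex \<times> complex \<Rightarrow> ennreal"
  assumes f[measurable]: "f \<in> borel_measurable (borel \<Otimes>\<^sub>M borel)"
    and c: "0 \<le> c" and cs: "c\<^sup>2 + (cmod s)\<^sup>2 = 1"
  shows "(\<integral>\<^sup>+p. f (of_real c * fst p + s * snd p, - cnj s * fst p + of_real c * snd p) \<partial>(lborel \<Otimes>\<^sub>M lborel)) =
    (\<integral>\<^sup>+p. f p \<partial>(lborel \<Otimes>\<^sub>M lborel))"
proof -
  define a where "a = (1 - of_real c) / cnj s"
  have ss: "s * cnj s = 1 - (of_real c)\<^sup>2"
  proof -
    have "s * cnj s = of_real ((cmod s)\<^sup>2)" by (simp only: complex_norm_square)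
    also have "(cmod s)\<^sup>2 = 1 - c\<^sup>2" using cs by simp
    finally show ?thesis by simp
  qed
  have "cnj s * a = 1 - of_real c"
  proof (cases "s = 0")
    case True
    then have "c = 1" using c cs by (simp add: power2_eq_1_iff)
    then show ?thesis using True by simp
  qed (simp add: a_def)
  moreover have "a * (1 + of_real c) = s"
  proof (cases "s = 0")
    case True then show ?thesis by (simp add: a_def)
  next
    case False
    have "a * (1 + of_real c) = (s * cnj s) / cnj s"
      unfolding ss by (simp add: a_def field_simps power2_eq_square)
    then show ?thesis using False by simp
  qed
  ultimately have a: "1 - cnj s * a = of_real c" "a + a * of_real c = s"
    by (simp_all add: algebra_simps)
  \<comment> \<open>\<open>g\<close> is \<open>f\<close> after the last of the three shears and
    \<open>h\<close> is \<open>f\<close> after the last two, so they are removed one at a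
    time.\<close>
  define g where "g p = f (fst p + a * snd p, snd p)" for p
  define h where "h p = g (fst p, snd p + (- cnj s) * fst p)" for p
  have [measurable]: "g \<in> borel_measurable (borel \<Otimes>\<^sub>M borel)" "h \<in> borel_measurable (borel \<Otimes>\<^sub>M borel)"
    unfolding g_def h_def by measurable
  have eq: "f (of_real c * z + s * y, - cnj s * z + of_real c * y) = h (z + a * y, y)" for z y
  proof -
    have 1: "y + (- cnj s) * (z + a * y) = - cnj s * z + of_real c * y"
      by (simp add: a(1)[symmetric] algebra_simps)
    have "z + a * y + a * (- cnj s * z + of_real c * y) = (1 - cnj s * a) * z + (a + a * of_real c) * y"
      by (simp add: algebra_simps)
    then have 2: "z + a * y + a * (- cnj s * z + of_real c * y) = of_real c * z + s * y"
      by (simp only: a)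
    show ?thesis
      by (simp only: h_def g_def fst_conv snd_conv 1 2)
  qed
  have "(\<integral>\<^sup>+p. f (of_real c * fst p + s * snd p, - cnj s * fst p + of_real c * snd p) \<partial>(lborel \<Otimes>\<^sub>M lborel)) =
      (\<integral>\<^sup>+p. h (fst p + a * snd p, snd p) \<partial>(lborel \<Otimes>\<^sub>M lborel))"
    by (simp only: eq)
  also have "\<dots> = (\<integral>\<^sup>+p. h p \<partial>(lborel \<Otimes>\<^sub>M lborel))" by (rule nn_integral_shear) simp
  also have "\<dots> = (\<integral>\<^sup>+p. g p \<partial>(lborel \<Otimes>\<^sub>M lborel))" unfolding h_def by (rule nn_integral_shear) simp
  also have "\<dots> = (\<integral>\<^sup>+p. f p \<partial>(lborel \<Otimes>\<^sub>M lborel))" unfolding g_def by (rule nn_integral_shear) simp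
  finally show ?thesis .
qed

lemma cmod_sq_eq: "of_real (cmod z * cmod z) = z * cnj z"
  by (metis complex_norm_square power2_eq_square)

text \<open>Unitarity of the rotation. Two different pairs are allowed since Gram entries couple
  different rows; equal pairs give norm preservation.\<close>

lemma givens_cnj:
  fixes z y z' y' s :: complex
  assumes cs: "c\<^sup>2 + (cmod s)\<^sup>2 = 1"
  shows "(of_real c * z + s * y) * cnj (of_real c * z' + s * y') +
    (- cnj s * z + of_real c * y) * cnj (- cnj s * z' + of_real c * y') = z * cnj z' + y * cnj y'"
proof -
  have "of_real c * of_real c + s * cnj s = (of_real (c\<^sup>2 + (cmod s)\<^sup>2) :: complex)"
    by (simp only: of_real_add complex_norm_square of_real_power power2_eq_square of_real_mult)
       (simp add: complex_norm_square[symmetric] power2_eq_square)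
  then have 1: "of_real c * of_real c + s * cnj s = 1" using cs by simp
  have "(of_real c * z + s * y) * cnj (of_real c * z' + s * y') +
    (- cnj s * z + of_real c * y) * cnj (- cnj s * z' + of_real c * y') =
    (of_real c * of_real c + s * cnj s) * (z * cnj z' + y * cnj y')"
    by (simp add: algebra_simps)
  then show ?thesis by (simp add: 1)
qed

lemma nn_integral_cgauss_pair:
  assumes [measurable]: "f \<in> borel_measurable (borel \<Otimes>\<^sub>M borel)"
  shows "(\<integral>\<^sup>+y. \<integral>\<^sup>+z. f (z, y) \<partial>cgauss \<partial>cgauss) =
    (\<integral>\<^sup>+p. f p * ennreal (exp (- (cmod (fst p) * cmod (fst p) + cmod (snd p) * cmod (snd p))) / (pi * pi)) \<partial>(lborel \<Otimes>\<^sub>M lborel))"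
proof -
  let ?g = "\<lambda>z. ennreal (exp (- (cmod z * cmod z)) / pi)"
  have "exp (- (cmod z * cmod z + cmod y * cmod y)) / (pi * pi) =
      exp (- (cmod y * cmod y)) / pi * (exp (- (cmod z * cmod z)) / pi)" for z y
    by (simp add: exp_add exp_minus exp_diff field_simps)
  then have g: "f (z, y) * ennreal (exp (- (cmod z * cmod z + cmod y * cmod y)) / (pi * pi)) =
      ?g y * (?g z * f (z, y))" for z y
    by (simp only: ennreal_mult' divide_nonneg_pos exp_ge_zero pi_gt_zero mult_ac)
  have "(\<integral>\<^sup>+y. \<integral>\<^sup>+z. f (z, y) \<partial>cgauss \<partial>cgauss) = (\<integral>\<^sup>+y. ?g y * (\<integral>\<^sup>+z. ?g z * f (z, y) \<partial>lborel) \<partial>lborel)"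
    unfolding cgauss_def by (simp add: nn_integral_density)
  also have "\<dots> = (\<integral>\<^sup>+y. \<integral>\<^sup>+z. f (z, y) * ennreal (exp (- (cmod z * cmod z + cmod y * cmod y)) / (pi * pi)) \<partial>lborel \<partial>lborel)"
    unfolding g by (intro nn_integral_cong nn_integral_cmult[symmetric]) measurable
  also have "\<dots> = (\<integral>\<^sup>+p. f p * ennreal (exp (- (cmod (fst p) * cmod (fst p) + cmod (snd p) * cmod (snd p))) / (pi * pi)) \<partial>(lborel \<Otimes>\<^sub>M lborel))"
    by (subst lborel_pair.nn_integral_snd[symmetric]) auto
  finally show ?thesis .
qed

text \<open>The rotation preserves Lebesgue measure, and it preserves the joint density, which
  depends only on the sum of the squared moduli.\<close>

lemma nn_integral_cgauss_givens:
  assumes f[measurable]: "f \<in> borel_measurable (borel \<Otimes>\<^sub>M borel)"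
    and c: "0 \<le> c" and cs: "c\<^sup>2 + (cmod s)\<^sup>2 = 1"
  shows "(\<integral>\<^sup>+y. \<integral>\<^sup>+z. f (of_real c * z + s * y, - cnj s * z + of_real c * y) \<partial>cgauss \<partial>cgauss) =
    (\<integral>\<^sup>+y. \<integral>\<^sup>+z. f (z, y) \<partial>cgauss \<partial>cgauss)"
proof -
  let ?R = "\<lambda>p. (of_real c * fst p + s * snd p, - cnj s * fst p + of_real c * snd p)"
  define d where "d p = ennreal (exp (- (cmod (fst p) * cmod (fst p) + cmod (snd p) * cmod (snd p))) / (pi * pi))"
    for p :: "complex \<times> complex"
  have [measurable]: "d \<in> borel_measurable (borel \<Otimes>\<^sub>M borel)" unfolding d_def by measurable
  have d: "d (?R p) = d p" for p
  proof -
    have "of_real (cmod (fst (?R p)) * cmod (fst (?R p)) + cmod (snd (?R p)) * cmod (snd (?R p))) =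
        (of_real (cmod (fst p) * cmod (fst p) + cmod (snd p) * cmod (snd p)) :: complex)"
      unfolding of_real_add cmod_sq_eq fst_conv snd_conv by (rule givens_cnj[OF cs])
    then show ?thesis by (simp only: d_def of_real_eq_iff)
  qed
  have "(\<integral>\<^sup>+y. \<integral>\<^sup>+z. f (of_real c * z + s * y, - cnj s * z + of_real c * y) \<partial>cgauss \<partial>cgauss) =
      (\<integral>\<^sup>+p. f (?R p) * d p \<partial>(lborel \<Otimes>\<^sub>M lborel))"
    unfolding d_def by (rule nn_integral_cgauss_pair[of "\<lambda>p. f (?R p)", unfolded fst_conv snd_conv]) measurable
  also have "\<dots> = (\<integral>\<^sup>+p. f (?R p) * d (?R p) \<partial>(lborel \<Otimes>\<^sub>M lborel))" by (simp only: d)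
  also have "\<dots> = (\<integral>\<^sup>+p. f p * d p \<partial>(lborel \<Otimes>\<^sub>M lborel))"
    by (rule nn_integral_lborel_givens[where f = "\<lambda>p. f p * d p", OF _ c cs]) measurable
  also have "\<dots> = (\<integral>\<^sup>+y. \<integral>\<^sup>+z. f (z, y) \<partial>cgauss \<partial>cgauss)"
    unfolding d_def by (rule nn_integral_cgauss_pair[symmetric]) measurable
  finally show ?thesis .
qed

section \<open>Rotation invariance\<close>

lemma borel_measurable_det_gram:
  assumes U: "\<And>a j. a < m \<Longrightarrow> j < k \<Longrightarrow> (\<lambda>x. U x (a, j)) \<in> borel_measurable N"
  shows "(\<lambda>x. Re (det (gram \<rho> m k (U x)))) \<in> borel_measurable N"
proof -
  have cnj: "(\<lambda>x. cnj (F x)) \<in> borel_measurable N" if "F \<in> borel_measurable N" for F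
    by (rule measurable_compose[OF that]) (intro borel_measurable_continuous_onI continuous_intros)
  have Re: "(\<lambda>x. Re (F x)) \<in> borel_measurable N" if "F \<in> borel_measurable N" for F
    by (rule measurable_compose[OF that]) (intro borel_measurable_continuous_onI continuous_intros)
  show ?thesis
    unfolding det_gram_expand
  proof (intro Re borel_measurable_sum)
    fix p assume "p \<in> {p. p permutes {0..<m}}"
    then have p: "p i < m" if "i < m" for i
      using that permutes_in_image[of p "{0..<m}" i] by simp
    show "(\<lambda>x. signof p * (\<Prod>i = 0..<m. (if i = p i then 1 else 0) +
        of_real \<rho> * (\<Sum>j<k. U x (i, j) * cnj (U x (p i, j))))) \<in> borel_measurable N"
      by (intro borel_measurable_times borel_measurable_const borel_measurable_prod
          borel_measurable_add borel_measurable_sum cnj U) (simp_all add: p)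
  qed
qed

lemma borel_measurable_det_gram_PiM:
  assumes "{0..<m} \<times> {0..<k} \<subseteq> I"
  shows "(\<lambda>h. Re (det (gram \<rho> m k h))) \<in> borel_measurable (PiM I (\<lambda>_. cgauss))"
proof (rule borel_measurable_det_gram)
  fix a j assume "a < m" "j < k"
  then have "(a, j) \<in> I" using assms by auto
  then show "(\<lambda>h. h (a, j)) \<in> borel_measurable (PiM I (\<lambda>_. cgauss))"
    by simp
qed

lemma measurable_PiM_cgauss_upd2:
  assumes "p \<in> I" "q \<in> I"
  shows "(\<lambda>h. h(p := of_real c * h p + s * h q, q := - cnj s * h p + of_real c * h q))
    \<in> measurable (PiM I (\<lambda>_. cgauss)) (PiM I (\<lambda>_. cgauss))"
proof -
  have I: "I = I \<union> {p}" "I = I \<union> {q}" using assms by auto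
  show ?thesis
    by (rule measurable_fun_upd[OF I(2)], rule measurable_fun_upd[OF I(1)]) (use assms in measurable)
qed

text \<open>The coordinates \<open>p\<close> and \<open>q\<close> are split off the product measure
  and rotated while all others stay fixed.\<close>

lemma nn_integral_PiM_cgauss_givens:
  assumes I: "finite I" "p \<in> I" "q \<in> I" "p \<noteq> q"
    and f[measurable]: "f \<in> borel_measurable (PiM I (\<lambda>_. cgauss))"
    and c: "0 \<le> c" and cs: "c\<^sup>2 + (cmod s)\<^sup>2 = 1"
  shows "(\<integral>\<^sup>+h. f (h(p := of_real c * h p + s * h q, q := - cnj s * h p + of_real c * h q)) \<partial>PiM I (\<lambda>_. cgauss)) =
    (\<integral>\<^sup>+h. f h \<partial>PiM I (\<lambda>_. cgauss))"
proof -
  define K where "K = I - {p, q}"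
  have K: "I = insert p (insert q K)" "finite K" "q \<notin> K" "p \<notin> insert q K" "finite (insert q K)"
    using I by (auto simp: K_def)
  have expand: "integral\<^sup>N (PiM I (\<lambda>_. cgauss)) F =
      (\<integral>\<^sup>+x. \<integral>\<^sup>+y. \<integral>\<^sup>+z. F (x(q := y, p := z)) \<partial>cgauss \<partial>cgauss \<partial>PiM K (\<lambda>_. cgauss))"
    if [measurable]: "F \<in> borel_measurable (PiM I (\<lambda>_. cgauss))" for F
  proof -
    have F: "F \<in> borel_measurable (PiM (insert p (insert q K)) (\<lambda>_. cgauss))"
      using that by (simp add: K(1)[symmetric])
    show ?thesis
      unfolding K(1) PiM_cgauss.product_nn_integral_insert[OF K(5,4) F]
    proof (rule PiM_cgauss.product_nn_integral_insert[OF K(2,3)])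
      have "(\<lambda>(x, z). F (x(p := z))) \<in> borel_measurable (PiM (insert q K) (\<lambda>_. cgauss) \<Otimes>\<^sub>M cgauss)"
        using measurable_compose[OF measurable_add_dim[of p "insert q K" "\<lambda>_. cgauss"] F] by (simp add: case_prod_beta)
      then show "(\<lambda>x. \<integral>\<^sup>+z. F (x(p := z)) \<partial>cgauss) \<in> borel_measurable (PiM (insert q K) (\<lambda>_. cgauss))"
        by (rule cgauss.borel_measurable_nn_integral)
    qed
  qed
  have "(\<integral>\<^sup>+y. \<integral>\<^sup>+z. f (x(q := - cnj s * z + of_real c * y, p := of_real c * z + s * y)) \<partial>cgauss \<partial>cgauss) =
      (\<integral>\<^sup>+y. \<integral>\<^sup>+z. f (x(q := y, p := z)) \<partial>cgauss \<partial>cgauss)" if x: "x \<in> space (PiM K (\<lambda>_. cgauss))" for x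
  proof -
    have "(\<lambda>w. x(q := snd w, p := fst w)) \<in> measurable (borel \<Otimes>\<^sub>M borel) (PiM I (\<lambda>_. cgauss))"
      by (rule measurable_fun_upd[where J = "insert q K"], use K in blast,
          rule measurable_fun_upd[where J = K], use K in blast)
         (use x in auto)
    from measurable_compose[OF this f] show ?thesis
      by (rule nn_integral_cgauss_givens[where f = "\<lambda>w. f (x(q := snd w, p := fst w))", OF _ c cs, unfolded fst_conv snd_conv])
  qed
  moreover have "(x(q := y, p := z))(p := of_real c * (x(q := y, p := z)) p + s * (x(q := y, p := z)) q,
      q := - cnj s * (x(q := y, p := z)) p + of_real c * (x(q := y, p := z)) q) =
      x(q := - cnj s * z + of_real c * y, p := of_real c * z + s * y)" for x y z
    using I(4) by (auto simp: fun_eq_iff)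
  ultimately show ?thesis
    using expand[OF f] expand[OF measurable_compose[OF measurable_PiM_cgauss_upd2[OF I(2,3)] f]]
    by (simp only: cong: nn_integral_cong)
qed

text \<open>The row set \<open>A\<close> is a parameter for two reasons: invariance of the law is
  proved by adding rows one by one, and the last row must be included for the Gram matrix but
  excluded for the random rows.\<close>

definition givens_cols :: "nat set \<Rightarrow> nat \<Rightarrow> nat \<Rightarrow> real \<Rightarrow> complex \<Rightarrow> (nat \<times> nat \<Rightarrow> complex) \<Rightarrow> nat \<times> nat \<Rightarrow> complex" where
  "givens_cols A i k c s u = (\<lambda>(a, j).
     if a \<in> A \<and> j = i then of_real c * u (a, i) + s * u (a, k)
     else if a \<in> A \<and> j = k then - cnj s * u (a, i) + of_real c * u (a, k)
     else u (a, j))"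

lemma nn_integral_givens_cols:
  assumes "finite A" "A \<subseteq> R" "finite R" "finite C" and ik: "i \<in> C" "k \<in> C" "i \<noteq> k"
    and f: "f \<in> borel_measurable (PiM (R \<times> C) (\<lambda>_. cgauss))"
    and c: "0 \<le> c" and cs: "c\<^sup>2 + (cmod s)\<^sup>2 = 1"
  shows "(\<integral>\<^sup>+h. f (givens_cols A i k c s h) \<partial>PiM (R \<times> C) (\<lambda>_. cgauss)) =
    (\<integral>\<^sup>+h. f h \<partial>PiM (R \<times> C) (\<lambda>_. cgauss))"
  using assms(1,2) f
proof (induction A arbitrary: f rule: finite_induct)
  case empty
  have "givens_cols {} i k c s h = h" for h by (auto simp: givens_cols_def)
  then show ?case by simp
next
  case (insert a A)
  let ?T = "\<lambda>h. h((a, i) := of_real c * h (a, i) + s * h (a, k), (a, k) := - cnj s * h (a, i) + of_real c * h (a, k))"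
  have fin: "finite (R \<times> C)" and a: "(a, i) \<in> R \<times> C" "(a, k) \<in> R \<times> C" "(a, i) \<noteq> (a, k)"
    using assms insert.prems by auto
  have eq: "givens_cols (insert a A) i k c s h = ?T (givens_cols A i k c s h)" for h
    using insert.hyps ik(3) by (auto simp: givens_cols_def fun_eq_iff)
  have "(\<lambda>h. f (?T h)) \<in> borel_measurable (PiM (R \<times> C) (\<lambda>_. cgauss))"
    using measurable_compose[OF measurable_PiM_cgauss_upd2[OF a(1,2)] insert.prems(2)] .
  then have "(\<integral>\<^sup>+h. f (?T (givens_cols A i k c s h)) \<partial>PiM (R \<times> C) (\<lambda>_. cgauss)) =
      (\<integral>\<^sup>+h. f (?T h) \<partial>PiM (R \<times> C) (\<lambda>_. cgauss))"
    using insert.IH insert.prems(1) by simp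
  also have "\<dots> = (\<integral>\<^sup>+h. f h \<partial>PiM (R \<times> C) (\<lambda>_. cgauss))"
    by (rule nn_integral_PiM_cgauss_givens[OF fin a insert.prems(2) c cs])
  finally show ?case by (simp only: eq)
qed

text \<open>Rotating all rows multiplies \<open>u\<close> on the right by a unitary matrix, which
  cancels in \<open>u u\<^sup>*\<close>.\<close>

lemma gram_givens_cols:
  assumes ik: "i < k" and cs: "c\<^sup>2 + (cmod s)\<^sup>2 = 1"
  shows "gram \<rho> m (Suc k) (givens_cols {0..<m} i k c s u) = gram \<rho> m (Suc k) u"
proof -
  have "(\<Sum>j<Suc k. givens_cols {0..<m} i k c s u (a, j) * cnj (givens_cols {0..<m} i k c s u (b, j))) =
      (\<Sum>j<Suc k. u (a, j) * cnj (u (b, j)))" if "a < m" "b < m" for a b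
  proof -
    have split: "(\<Sum>j<Suc k. F j) = (F i + F k) + (\<Sum>j\<in>{..<k} - {i}. F j)" for F :: "nat \<Rightarrow> complex"
      using ik by (simp add: sum.remove[of "{..<k}" i])
    have "(\<Sum>j\<in>{..<k} - {i}. givens_cols {0..<m} i k c s u (a, j) * cnj (givens_cols {0..<m} i k c s u (b, j))) =
        (\<Sum>j\<in>{..<k} - {i}. u (a, j) * cnj (u (b, j)))"
      by (intro sum.cong) (auto simp: givens_cols_def)
    moreover have "givens_cols {0..<m} i k c s u (a', i) = of_real c * u (a', i) + s * u (a', k)"
      "givens_cols {0..<m} i k c s u (a', k) = - cnj s * u (a', i) + of_real c * u (a', k)" if "a' < m" for a'
      using that ik by (auto simp: givens_cols_def)
    ultimately show ?thesis
      unfolding split using that by (simp only: givens_cnj[OF cs])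
  qed
  then show ?thesis by (auto simp: gram_def intro!: eq_matI)
qed

lemma givens_coefficients_exist:
  obtains c s where "0 \<le> c" "c\<^sup>2 + (cmod s)\<^sup>2 = 1" "of_real c * z + s * y = 0"
proof (cases "y = 0")
  \<comment> \<open>For \<open>y = 0\<close> the rotation exchanges the two coordinates up to
    sign.\<close>
  case True
  then show ?thesis using that[of 0 1] by simp
next
  case False
  define N where "N = sqrt ((cmod z)\<^sup>2 + (cmod y)\<^sup>2)"
  have N: "N\<^sup>2 = (cmod z)\<^sup>2 + (cmod y)\<^sup>2" "0 < N"
    using False by (auto simp: N_def add_nonneg_pos)
  show ?thesis
  proof (rule that)
    show "0 \<le> cmod y / N" using N by simp
    show "of_real (cmod y / N) * z + (- of_real (cmod y / N) * z / y) * y = 0" using False by simp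
    have "cmod (- of_real (cmod y / N) * z / y) = cmod z / N"
      using False N by (simp add: norm_mult norm_divide)
    then show "(cmod y / N)\<^sup>2 + (cmod (- of_real (cmod y / N) * z / y))\<^sup>2 = 1"
      using N False by (simp add: power_divide add_divide_distrib[symmetric])
  qed
qed

definition with_row :: "nat \<Rightarrow> (nat \<Rightarrow> complex) \<Rightarrow> (nat \<times> nat \<Rightarrow> complex) \<Rightarrow> nat \<times> nat \<Rightarrow> complex" where
  "with_row m w u = (\<lambda>(a, j). if a = m then w j else u (a, j))"

lemma borel_measurable_det_gram_with_row:
  "(\<lambda>u. Re (det (gram \<rho> (Suc m) k (with_row m w u)))) \<in> borel_measurable (PiM ({0..<m} \<times> {0..<k}) (\<lambda>_. cgauss))"
proof (rule borel_measurable_det_gram)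
  fix a j assume aj: "a < Suc m" "j < k"
  show "(\<lambda>u. with_row m w u (a, j)) \<in> borel_measurable (PiM ({0..<m} \<times> {0..<k}) (\<lambda>_. cgauss))"
    using aj by (cases "a = m") (auto simp: with_row_def)
qed

text \<open>A deterministic last row may be rotated onto the last coordinate axis: the rotation leaves
  the Gram matrix unchanged and the law of the remaining Gaussian rows invariant.\<close>

lemma rotate_last_row_to_axis:
  assumes g[measurable]: "g \<in> borel_measurable borel" and "i \<le> k"
  obtains w' where "\<And>j. j < i \<Longrightarrow> w' j = 0"
    and "(\<Sum>j<Suc k. (cmod (w' j))\<^sup>2) = (\<Sum>j<Suc k. (cmod (w j))\<^sup>2)"
    and "(\<integral>\<^sup>+u. g (Re (det (gram \<rho> (Suc m) (Suc k) (with_row m w' u)))) \<partial>PiM ({0..<m} \<times> {0..<Suc k}) (\<lambda>_. cgauss)) =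
      (\<integral>\<^sup>+u. g (Re (det (gram \<rho> (Suc m) (Suc k) (with_row m w u)))) \<partial>PiM ({0..<m} \<times> {0..<Suc k}) (\<lambda>_. cgauss))"
  using assms(2)
proof (induction i arbitrary: thesis)
  case 0
  then show ?case by blast
next
  case (Suc i)
  let ?P = "PiM ({0..<m} \<times> {0..<Suc k}) (\<lambda>_. cgauss)"
  let ?F = "\<lambda>w u. g (Re (det (gram \<rho> (Suc m) (Suc k) (with_row m w u))))"
  obtain w' where w': "\<And>j. j < i \<Longrightarrow> w' j = 0"
    "(\<Sum>j<Suc k. (cmod (w' j))\<^sup>2) = (\<Sum>j<Suc k. (cmod (w j))\<^sup>2)"
    "(\<integral>\<^sup>+u. ?F w' u \<partial>?P) = (\<integral>\<^sup>+u. ?F w u \<partial>?P)"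
    using Suc.IH Suc.prems(2) by auto
  obtain c s where c: "0 \<le> c" and cs: "c\<^sup>2 + (cmod s)\<^sup>2 = 1" and z: "of_real c * w' i + s * w' k = 0"
    by (rule givens_coefficients_exist)
  \<comment> \<open>Coordinate \<open>i\<close> is rotated into coordinate \<open>k\<close>; the
    zeros already produced below \<open>i\<close> are untouched.\<close>
  define w2 where "w2 = w'(i := 0, k := - cnj s * w' i + of_real c * w' k)"
  have ik: "i < k" using Suc.prems(2) by simp
  have F: "?F w2 \<in> borel_measurable ?P"
    using measurable_compose[OF borel_measurable_det_gram_with_row g] .
  \<comment> \<open>Rotating the full matrix keeps its determinant and acts separately on the fixed
    row and on the random rows, whose law absorbs the rotation.\<close>
  have rot: "givens_cols {0..<Suc m} i k c s (with_row m w' u) = with_row m w2 (givens_cols {0..<m} i k c s u)" for u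
    using z ik by (auto simp: givens_cols_def with_row_def w2_def fun_eq_iff)
  have "?F w' u = ?F w2 (givens_cols {0..<m} i k c s u)" for u
    unfolding rot[symmetric] gram_givens_cols[OF ik cs] ..
  then have "(\<integral>\<^sup>+u. ?F w' u \<partial>?P) = (\<integral>\<^sup>+u. ?F w2 (givens_cols {0..<m} i k c s u) \<partial>?P)" by simp
  also have "\<dots> = (\<integral>\<^sup>+u. ?F w2 u \<partial>?P)"
    by (rule nn_integral_givens_cols[OF _ _ _ _ _ _ _ F c cs]) (use ik in auto)
  finally have int: "(\<integral>\<^sup>+u. ?F w2 u \<partial>?P) = (\<integral>\<^sup>+u. ?F w u \<partial>?P)" using w'(3) by simp
  have "of_real ((cmod (of_real c * w' i + s * w' k))\<^sup>2 + (cmod (- cnj s * w' i + of_real c * w' k))\<^sup>2) =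
      (of_real ((cmod (w' i))\<^sup>2 + (cmod (w' k))\<^sup>2) :: complex)"
    unfolding of_real_add complex_norm_square by (rule givens_cnj[OF cs])
  then have "(cmod (of_real c * w' i + s * w' k))\<^sup>2 + (cmod (- cnj s * w' i + of_real c * w' k))\<^sup>2 =
      (cmod (w' i))\<^sup>2 + (cmod (w' k))\<^sup>2"
    by (simp only: of_real_eq_iff)
  then have norm2: "(cmod (w2 i))\<^sup>2 + (cmod (w2 k))\<^sup>2 = (cmod (w' i))\<^sup>2 + (cmod (w' k))\<^sup>2"
    using z ik by (simp add: w2_def)
  have split: "(\<Sum>j<Suc k. F j) = (F i + F k) + (\<Sum>j\<in>{..<k} - {i}. F j)" for F :: "nat \<Rightarrow> real"
    using ik by (simp add: sum.remove[of "{..<k}" i])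
  have "(\<Sum>j\<in>{..<k} - {i}. (cmod (w2 j))\<^sup>2) = (\<Sum>j\<in>{..<k} - {i}. (cmod (w' j))\<^sup>2)"
    by (intro sum.cong) (auto simp: w2_def)
  then have "(\<Sum>j<Suc k. (cmod (w2 j))\<^sup>2) = (\<Sum>j<Suc k. (cmod (w j))\<^sup>2)"
    unfolding w'(2)[symmetric] split norm2 by simp
  moreover have "w2 j = 0" if "j < Suc i" for j
    using that w'(1) ik by (auto simp: w2_def less_Suc_eq)
  ultimately show ?case using Suc.prems(1) int by blast
qed

section \<open>Comparison with a product of independent Gamma variables\<close>

text \<open>With the fixed row on the last axis, the determinant is at least
  \<open>1 + \<rho> |w|^2\<close> times that of the first \<open>k\<close> columns of the random
  rows, so \<open>w\<close> survives only through its norm.\<close>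

lemma emeasure_det_gram_with_row_le:
  assumes \<rho>: "0 \<le> \<rho>"
  shows "emeasure (PiM ({0..<m} \<times> {0..<Suc k}) (\<lambda>_. cgauss))
      {u \<in> space (PiM ({0..<m} \<times> {0..<Suc k}) (\<lambda>_. cgauss)). Re (det (gram \<rho> (Suc m) (Suc k) (with_row m w u))) < t} \<le>
    emeasure (PiM ({0..<m} \<times> {0..<k}) (\<lambda>_. cgauss))
      {u \<in> space (PiM ({0..<m} \<times> {0..<k}) (\<lambda>_. cgauss)).
        Re (det (gram \<rho> m k u)) < t / (1 + \<rho> * (\<Sum>j<Suc k. (cmod (w j))\<^sup>2))}"
proof -
  let ?J = "{0..<m} \<times> {0..<k}"
  let ?P = "PiM ({0..<m} \<times> {0..<Suc k}) (\<lambda>_. cgauss)" and ?Q = "PiM ?J (\<lambda>_. cgauss)"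
  let ?D = "\<lambda>w u. Re (det (gram \<rho> (Suc m) (Suc k) (with_row m w u)))"
  let ?S = "\<Sum>j<Suc k. (cmod (w j))\<^sup>2"
  let ?B = "{u \<in> space ?Q. Re (det (gram \<rho> m k u)) < t / (1 + \<rho> * ?S)}"
  note [measurable] = borel_measurable_det_gram_with_row[where \<rho> = \<rho> and m = m and k = "Suc k"]
    borel_measurable_det_gram_PiM[where m = m and k = k and I = ?J and \<rho> = \<rho>, OF subset_refl]
  obtain w' where w': "\<And>j. j < k \<Longrightarrow> w' j = 0" "(\<Sum>j<Suc k. (cmod (w' j))\<^sup>2) = ?S"
    "(\<integral>\<^sup>+u. indicator {..<t} (?D w' u) \<partial>?P) = (\<integral>\<^sup>+u. indicator {..<t} (?D w u) \<partial>?P)"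
    by (rule rotate_last_row_to_axis[where g = "indicator {..<t}" and i = k and k = k and w = w and \<rho> = \<rho> and m = m]) auto
  have r: "(cmod (w' k))\<^sup>2 = ?S" using w'(1,2) by simp
  have pos: "0 < 1 + \<rho> * ?S" using \<rho> by (simp add: add_pos_nonneg sum_nonneg)
  have ind: "emeasure ?P {u \<in> space ?P. ?D v u < t} = (\<integral>\<^sup>+u. indicator {..<t} (?D v u) \<partial>?P)" for v
  proof -
    have "emeasure ?P {u \<in> space ?P. ?D v u < t} = (\<integral>\<^sup>+u. indicator {u \<in> space ?P. ?D v u < t} u \<partial>?P)"
      by (rule nn_integral_indicator[symmetric]) measurable
    also have "\<dots> = (\<integral>\<^sup>+u. indicator {..<t} (?D v u) \<partial>?P)"
      by (intro nn_integral_cong) (auto simp: indicator_def)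
    finally show ?thesis .
  qed
  have le: "Re (det (gram \<rho> m k u)) < t / (1 + \<rho> * ?S)" if "?D w' u < t" for u
  proof -
    have "(1 + \<rho> * ?S) * Re (det (gram \<rho> m k (with_row m w' u))) \<le> ?D w' u"
      using det_gram_last_row_axis_ge[OF \<rho>, of k "with_row m w' u" m] w'(1) r
      by (simp add: with_row_def)
    moreover have "gram \<rho> m k (with_row m w' u) = gram \<rho> m k u"
      by (rule gram_cong) (auto simp: with_row_def)
    ultimately have "(1 + \<rho> * ?S) * Re (det (gram \<rho> m k u)) < t" using that by simp
    then show ?thesis using pos by (simp add: pos_less_divide_eq mult.commute)
  qed
  have "emeasure ?P {u \<in> space ?P. ?D w u < t} = emeasure ?P {u \<in> space ?P. ?D w' u < t}"
    unfolding ind w'(3) ..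
  also have "\<dots> \<le> emeasure ?P {u \<in> space ?P. Re (det (gram \<rho> m k u)) < t / (1 + \<rho> * ?S)}"
  proof (rule emeasure_mono)
    show "{u \<in> space ?P. Re (det (gram \<rho> m k u)) < t / (1 + \<rho> * ?S)} \<in> sets ?P"
      by (rule borel_measurable_less[OF borel_measurable_det_gram_PiM]) auto
  qed (use le in blast)
  \<comment> \<open>The event now reads only the first \<open>k\<close> columns, so the last one is
    integrated out by restriction.\<close>
  also have "{u \<in> space ?P. Re (det (gram \<rho> m k u)) < t / (1 + \<rho> * ?S)} = (\<lambda>u. restrict u ?J) -` ?B \<inter> space ?P"
  proof -
    have "gram \<rho> m k (restrict u ?J) = gram \<rho> m k u" for u
      by (rule gram_cong) auto
    then show ?thesis by (auto simp: space_PiM)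
  qed
  also have "emeasure ?P \<dots> = emeasure (distr ?P ?Q (\<lambda>u. restrict u ?J)) ?B"
    by (rule emeasure_distr[symmetric]) (measurable, auto intro!: measurable_restrict_subset)
  also have "distr ?P ?Q (\<lambda>u. restrict u ?J) = ?Q"
    by (rule PiM_cgauss.distr_restrict[symmetric]) auto
  finally show ?thesis .
qed

text \<open>This is the Gamma law of shape \<open>n + 1\<close> and rate one.\<close>

abbreviation "erlang_measure n \<equiv> density lborel (\<lambda>x. ennreal (erlang_density n 1 x))"

lemma product_prob_space_erlang: "product_prob_space (\<lambda>l. erlang_measure (d + l))"
proof -
  have p: "prob_space (erlang_measure n)" for n by (rule prob_space_erlang_density) simp
  interpret prob_space "erlang_measure n" for n by (rule p)
  show ?thesis by unfold_locales
qed

text \<open>Conditioning on the last row \<open>v\<close>, the determinant dominates \<open>1 + \<rho> \<parallel>v\<parallel>\<^sup>2\<close> times an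
  independent determinant with one row and one column less.\<close>

lemma emeasure_det_gram_less_le:
  assumes \<rho>: "0 \<le> \<rho>"
  shows "emeasure (PiM ({0..<m} \<times> {0..<m + d}) (\<lambda>_. cgauss))
      {h \<in> space (PiM ({0..<m} \<times> {0..<m + d}) (\<lambda>_. cgauss)). Re (det (gram \<rho> m (m + d) h)) < t} \<le>
    emeasure (PiM {0..<m} (\<lambda>l. erlang_measure (d + l)))
      {x \<in> space (PiM {0..<m} (\<lambda>l. erlang_measure (d + l))). (\<Prod>l<m. 1 + \<rho> * x l) < t}"
proof (induction m arbitrary: t)
  case 0
  interpret P: prob_space "PiM {} (\<lambda>_. cgauss) :: (nat \<times> nat \<Rightarrow> complex) measure"
    by (rule prob_space_PiM) (rule prob_space_cgauss)
  have "det (gram \<rho> 0 d h) = 1" for h using det_dim_zero[OF gram_carrier] by blast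
  moreover have "prob_space (PiM {} (\<lambda>l. erlang_measure (d + l)) :: (nat \<Rightarrow> real) measure)"
    by (rule prob_space_PiM) simp
  ultimately show ?case
    using P.emeasure_space_1 prob_space.emeasure_space_1 by (cases "1 < t") force+
next
  case (Suc m)
  define k where "k = m + d"
  let ?I = "{m} \<times> {0..<Suc k}" and ?J = "{0..<m} \<times> {0..<Suc k}"
  let ?P = "PiM ?J (\<lambda>_. cgauss)" and ?V = "PiM ?I (\<lambda>_. cgauss)"
  let ?PQ = "PiM ({0..<Suc m} \<times> {0..<Suc k}) (\<lambda>_. cgauss)"
  let ?D = "\<lambda>h. Re (det (gram \<rho> (Suc m) (Suc k) h))"
  let ?E = "\<lambda>l. erlang_measure (d + l)"
  let ?S = "PiM {0..<m} ?E"
  let ?sq = "\<lambda>v. \<Sum>i\<in>?I. (cmod (v i))\<^sup>2"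
  interpret E: product_prob_space ?E UNIV
    using product_prob_space_erlang by blast
  define G where "G x = (indicator {..<t} (\<Prod>l<Suc m. 1 + \<rho> * x l) :: ennreal)" for x :: "nat \<Rightarrow> real"
  \<comment> \<open>\<open>\<phi> x\<close> is the probability of the target event once the factor
    with index \<open>m\<close> has the value \<open>x\<close>; it bounds the conditional
    probability given a last row of squared norm \<open>x\<close>.\<close>
  define \<phi> where "\<phi> x = (\<integral>\<^sup>+y. G (y(m := x)) \<partial>?S)" for x
  have prod_meas: "(\<lambda>x. \<Prod>l<n. 1 + \<rho> * x l) \<in> borel_measurable (PiM {0..<n} ?E)" for n
  proof (intro borel_measurable_prod borel_measurable_add borel_measurable_times borel_measurable_const)
    fix l assume "l \<in> {..<n}"
    then show "(\<lambda>x. x l) \<in> borel_measurable (PiM {0..<n} ?E)"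
      using measurable_component_singleton[of l "{0..<n}" ?E] by simp
  qed
  have ins: "insert m {0..<m} = {0..<Suc m}" by auto
  have less_meas: "{x \<in> space (PiM {0..<n} ?E). (\<Prod>l<n. 1 + \<rho> * x l) < a} \<in> sets (PiM {0..<n} ?E)" for n a
    using prod_meas[of n] by (rule borel_measurable_less) simp
  have G: "G \<in> borel_measurable (PiM (insert m {0..<m}) ?E)"
    unfolding G_def ins by (rule measurable_compose[OF prod_meas]) simp
  have \<phi>: "\<phi> \<in> borel_measurable borel"
  proof -
    interpret S: prob_space ?S by (rule prob_space_PiM) (rule E.prob_space)
    have "(\<lambda>p. (snd p)(m := fst p)) \<in> measurable (borel \<Otimes>\<^sub>M ?S) (PiM (insert m {0..<m}) ?E)"
      by (rule measurable_fun_upd[where J = "{0..<m}"]) auto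
    from measurable_compose[OF this G] show ?thesis
      unfolding \<phi>_def by (intro S.borel_measurable_nn_integral) (simp add: case_prod_beta)
  qed
  have IJ: "?I \<union> ?J = {0..<Suc m} \<times> {0..<Suc k}" "?I \<inter> ?J = {}" by auto
  have D: "?D \<in> borel_measurable ?PQ" by (rule borel_measurable_det_gram_PiM) simp
  have ind: "(\<lambda>h. indicator {..<t} (?D h) :: ennreal) \<in> borel_measurable (PiM (?I \<union> ?J) (\<lambda>_. cgauss))"
    unfolding IJ by (rule measurable_compose[OF D]) simp
  have inner: "(\<integral>\<^sup>+u. indicator {..<t} (?D (merge ?I ?J (v, u))) \<partial>?P) \<le> \<phi> (?sq v)" for v
  proof -
    define w where "w j = v (m, j)" for j
    have sq: "?sq v = (\<Sum>j<Suc k. (cmod (w j))\<^sup>2)"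
      unfolding w_def by (rule sum.reindex_bij_witness[of _ "\<lambda>j. (m, j)" snd]) auto
    have pos: "0 < 1 + \<rho> * ?sq v" using \<rho> by (simp add: add_pos_nonneg sum_nonneg)
    have "gram \<rho> (Suc m) (Suc k) (merge ?I ?J (v, u)) = gram \<rho> (Suc m) (Suc k) (with_row m w u)" for u
      by (rule gram_cong) (auto simp: merge_def with_row_def w_def)
    then have "(\<integral>\<^sup>+u. indicator {..<t} (?D (merge ?I ?J (v, u))) \<partial>?P) =
        (\<integral>\<^sup>+u. indicator {u \<in> space ?P. ?D (with_row m w u) < t} u \<partial>?P)"
      by (intro nn_integral_cong) (auto simp: indicator_def)
    also have "\<dots> = emeasure ?P {u \<in> space ?P. ?D (with_row m w u) < t}"
      by (rule nn_integral_indicator) (rule borel_measurable_less[OF borel_measurable_det_gram_with_row], simp)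
    also have "\<dots> \<le> emeasure (PiM ({0..<m} \<times> {0..<k}) (\<lambda>_. cgauss))
      {u \<in> space (PiM ({0..<m} \<times> {0..<k}) (\<lambda>_. cgauss)). Re (det (gram \<rho> m k u)) < t / (1 + \<rho> * ?sq v)}"
      unfolding sq by (rule emeasure_det_gram_with_row_le[OF \<rho>])
    also have "\<dots> \<le> emeasure ?S {y \<in> space ?S. (\<Prod>l<m. 1 + \<rho> * y l) < t / (1 + \<rho> * ?sq v)}"
      unfolding k_def by (rule Suc.IH)
    also have "\<dots> = (\<integral>\<^sup>+y. indicator {y \<in> space ?S. (\<Prod>l<m. 1 + \<rho> * y l) < t / (1 + \<rho> * ?sq v)} y \<partial>?S)"
      by (rule nn_integral_indicator[symmetric]) (rule less_meas)
    also have "\<dots> = \<phi> (?sq v)"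
      unfolding \<phi>_def G_def
      using pos by (intro nn_integral_cong) (auto simp: indicator_def pos_less_divide_eq)
    finally show ?thesis .
  qed
  have "emeasure ?PQ {h \<in> space ?PQ. ?D h < t} = (\<integral>\<^sup>+h. indicator {h \<in> space ?PQ. ?D h < t} h \<partial>?PQ)"
    by (rule nn_integral_indicator[symmetric]) (rule borel_measurable_less[OF D], simp)
  also have "\<dots> = (\<integral>\<^sup>+h. indicator {..<t} (?D h) \<partial>PiM (?I \<union> ?J) (\<lambda>_. cgauss))"
    unfolding IJ by (intro nn_integral_cong) (auto simp: indicator_def)
  also have "\<dots> = (\<integral>\<^sup>+v. \<integral>\<^sup>+u. indicator {..<t} (?D (merge ?I ?J (v, u))) \<partial>?P \<partial>?V)"
    by (rule PiM_cgauss.product_nn_integral_fold[OF IJ(2) _ _ ind]) auto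
  also have "\<dots> \<le> (\<integral>\<^sup>+v. \<phi> (?sq v) \<partial>?V)"
    by (intro nn_integral_mono inner)
  also have "\<dots> = (\<integral>\<^sup>+x. \<phi> x \<partial>distr ?V borel ?sq)"
    by (rule nn_integral_distr[symmetric]) (use \<phi> in auto)
  \<comment> \<open>The last row has \<open>k + 1 = d + m + 1\<close> entries, so its squared norm
    is exactly the new comparison variable.\<close>
  also have "distr ?V borel ?sq = ?E m"
    by (subst distr_PiM_cgauss_sum_cmod_sq) (auto simp: k_def add.commute)
  also have "(\<integral>\<^sup>+x. \<phi> x \<partial>?E m) = (\<integral>\<^sup>+x. G x \<partial>PiM (insert m {0..<m}) ?E)"
    unfolding \<phi>_def by (rule E.product_nn_integral_insert_rev[symmetric]) (use G in auto)
  also have "\<dots> = (\<integral>\<^sup>+x. indicator {x \<in> space (PiM {0..<Suc m} ?E). (\<Prod>l<Suc m. 1 + \<rho> * x l) < t} x \<partial>PiM {0..<Suc m} ?E)"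
    unfolding ins G_def by (intro nn_integral_cong) (auto simp: indicator_def)
  also have "\<dots> = emeasure (PiM {0..<Suc m} ?E) {x \<in> space (PiM {0..<Suc m} ?E). (\<Prod>l<Suc m. 1 + \<rho> * x l) < t}"
    by (rule nn_integral_indicator) (rule less_meas)
  finally show ?case by (simp only: k_def add_Suc)
qed

section \<open>Gamma probabilities of boxes\<close>

text \<open>The strict bound comes from the strict outage inequality; the endpoint is a null set, so
  the closed integral in \<open>Gamma_inc\<close> gives the same value.\<close>

lemma measure_erlang_lessThan:
  assumes "0 \<le> x"
  shows "measure (erlang_measure n) {..<x} = Gamma_inc x (Suc n)"
proof -
  let ?f = "\<lambda>t :: real. t ^ n * exp (- t) / fact n"
  have "continuous_on {0..x} ?f" by (intro continuous_intros) auto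
  then have "(?f has_integral integral {0..x} ?f) {0..x}"
    using integrable_continuous_real integrable_integral by blast
  then have int: "(\<integral>\<^sup>+t. ennreal (?f t) * indicator {0..x} t \<partial>lborel) = ennreal (integral {0..x} ?f)"
    by (intro nn_integral_has_integral_lebesgue') auto
  have "emeasure (erlang_measure n) {..<x} = (\<integral>\<^sup>+t. ennreal (erlang_density n 1 t) * indicator {..<x} t \<partial>lborel)"
    by (rule emeasure_density) auto
  also have "\<dots> = (\<integral>\<^sup>+t. ennreal (?f t) * indicator {0..x} t \<partial>lborel)"
    using AE_lborel_singleton[of x]
    by (intro nn_integral_cong_AE) (auto simp: erlang_density_def indicator_def elim!: eventually_mono)
  finally have "emeasure (erlang_measure n) {..<x} = ennreal (integral {0..x} ?f)"
    using int by simp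
  moreover have "0 \<le> integral {0..x} ?f" by (intro integral_nonneg integrable_continuous_real continuous_intros) auto
  ultimately have "measure (erlang_measure n) {..<x} = integral {0..x} ?f"
    by (simp add: measure_def)
  then show ?thesis by (simp add: Gamma_inc_def)
qed

text \<open>If \<open>x \<ge> 0\<close> and the product is below \<open>t = 1 + \<rho> X\<close>, then every \<open>x l < X\<close>, and some
  \<open>x l < \<beta> l\<close> because otherwise the product would be at least \<open>\<Prod>l<m. 1 + \<rho> \<beta> l \<ge> t\<close>.\<close>

lemma measure_erlang_prod_less_le:
  assumes \<rho>: "0 < \<rho>" and \<beta>: "\<And>l. l < m \<Longrightarrow> 0 \<le> \<beta> l \<and> \<beta> l \<le> X"
    and t: "t = 1 + \<rho> * X" and X: "0 \<le> X" and ge: "t \<le> (\<Prod>l<m. 1 + \<rho> * \<beta> l)"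
  shows "measure (PiM {0..<m} (\<lambda>l. erlang_measure (d + l)))
      {x \<in> space (PiM {0..<m} (\<lambda>l. erlang_measure (d + l))). (\<Prod>l<m. 1 + \<rho> * x l) < t} \<le>
    (\<Prod>l<m. Gamma_inc X (Suc (d + l))) - (\<Prod>l<m. Gamma_inc X (Suc (d + l)) - Gamma_inc (\<beta> l) (Suc (d + l)))"
proof -
  let ?E = "\<lambda>l. erlang_measure (d + l)"
  let ?S = "PiM {0..<m} ?E"
  \<comment> \<open>Both sets are boxes, so their probabilities factor; \<open>?U - ?V\<close> means
    that all coordinates lie below \<open>X\<close> and some one lies below its
    \<open>\<beta> l\<close>.\<close>
  let ?U = "PiE {0..<m} (\<lambda>_. {..<X})" and ?V = "PiE {0..<m} (\<lambda>l. {\<beta> l..<X})"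
  interpret E: product_prob_space ?E UNIV using product_prob_space_erlang by blast
  interpret S: finite_product_prob_space ?E "{0..<m}" by unfold_locales simp
  have sets: "?U \<in> sets ?S" "?V \<in> sets ?S" by (auto intro!: sets_PiM_I_finite)
  have "?V \<subseteq> ?U" by (auto simp: PiE_iff)
  have "AE x in ?S. 0 \<le> x l" if "l \<in> {0..<m}" for l
  proof (rule AE_PiM_component[OF _ that])
    show "AE x in ?E l. 0 \<le> x"
      by (subst AE_density) (auto simp: erlang_density_def)
  qed (rule E.prob_space)
  then have "AE x in ?S. \<forall>l\<in>{0..<m}. 0 \<le> x l" by (intro AE_finite_allI) auto
  then have "AE x in ?S. x \<in> {x \<in> space ?S. (\<Prod>l<m. 1 + \<rho> * x l) < t} \<longrightarrow> x \<in> ?U - ?V"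
  proof (rule eventually_mono, intro impI)
    fix x assume nn: "\<forall>l\<in>{0..<m}. 0 \<le> x l" and x: "x \<in> {x \<in> space ?S. (\<Prod>l<m. 1 + \<rho> * x l) < t}"
    have "x l < X" if l: "l < m" for l
    proof -
      have "1 * (1 + \<rho> * x l) \<le> (\<Prod>i\<in>{..<m} - {l}. 1 + \<rho> * x i) * (1 + \<rho> * x l)"
        using nn l \<rho> by (intro mult_right_mono prod_ge_1) auto
      also have "\<dots> = (\<Prod>l<m. 1 + \<rho> * x l)"
        using l by (simp add: prod.remove[of "{..<m}" l] mult.commute)
      finally have "\<rho> * x l < \<rho> * X" using x t by simp
      then show ?thesis using \<rho> by simp
    qed
    then have U: "x \<in> ?U" using x by (auto simp: space_PiM PiE_iff)
    have "x \<notin> ?V"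
    proof
      assume "x \<in> ?V"
      then have "(\<Prod>l<m. 1 + \<rho> * \<beta> l) \<le> (\<Prod>l<m. 1 + \<rho> * x l)"
        using \<beta> \<rho> by (intro prod_mono) (auto simp: PiE_iff)
      then show False using ge x by simp
    qed
    with U show "x \<in> ?U - ?V" by simp
  qed
  then have "measure ?S {x \<in> space ?S. (\<Prod>l<m. 1 + \<rho> * x l) < t} \<le> measure ?S (?U - ?V)"
    using sets by (intro S.finite_measure_mono_AE) auto
  also have "\<dots> = measure ?S ?U - measure ?S ?V"
    using sets \<open>?V \<subseteq> ?U\<close> by (intro S.finite_measure_Diff)
  also have "measure ?S ?U = (\<Prod>l<m. Gamma_inc X (Suc (d + l)))"
    by (subst S.prob_times) (simp_all add: measure_erlang_lessThan X lessThan_atLeast0)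
  also have "measure ?S ?V = (\<Prod>l\<in>{0..<m}. measure (?E l) {\<beta> l..<X})"
    by (rule S.prob_times) simp
  also have "\<dots> = (\<Prod>l<m. Gamma_inc X (Suc (d + l)) - Gamma_inc (\<beta> l) (Suc (d + l)))"
    unfolding lessThan_atLeast0
  proof (rule prod.cong[OF refl])
    fix l assume "l \<in> {0..<m}"
    then have l: "0 \<le> \<beta> l" "\<beta> l \<le> X" using \<beta> by auto
    have "measure (?E l) ({..<X} - {..<\<beta> l}) = measure (?E l) {..<X} - measure (?E l) {..<\<beta> l}"
      using l by (intro E.M.finite_measure_Diff) auto
    moreover have "{..<X} - {..<\<beta> l} = {\<beta> l..<X}" by auto
    ultimately show "measure (?E l) {\<beta> l..<X} = Gamma_inc X (Suc (d + l)) - Gamma_inc (\<beta> l) (Suc (d + l))"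
      using l X by (simp add: measure_erlang_lessThan)
  qed
  finally show ?thesis .
qed

lemma Gamma_inc_mono:
  assumes "0 \<le> x" "x \<le> y"
  shows "Gamma_inc x (Suc n) \<le> Gamma_inc y (Suc n)" "0 \<le> Gamma_inc x (Suc n)"
proof -
  interpret prob_space "erlang_measure n" by (rule prob_space_erlang_density) simp
  have "measure (erlang_measure n) {..<x} \<le> measure (erlang_measure n) {..<y}"
    using assms by (intro finite_measure_mono) auto
  then show "Gamma_inc x (Suc n) \<le> Gamma_inc y (Suc n)"
    using assms by (simp add: measure_erlang_lessThan)
  show "0 \<le> Gamma_inc x (Suc n)"
    unfolding measure_erlang_lessThan[OF assms(1), symmetric] by (rule measure_nonneg)
qed

section \<open>Transposition and assembly of the bound\<close>

text \<open>Transposing the index pairs keeps the law of the i.i.d. entries, and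
  \<open>det_gram_swap\<close> keeps the determinant.\<close>

lemma measure_det_gram_swap:
  "measure (PiM ({0..<r} \<times> {0..<c}) (\<lambda>_. cgauss)) {h \<in> space (PiM ({0..<r} \<times> {0..<c}) (\<lambda>_. cgauss)). Re (det (gram \<rho> r c h)) < t} =
   measure (PiM ({0..<c} \<times> {0..<r}) (\<lambda>_. cgauss)) {h \<in> space (PiM ({0..<c} \<times> {0..<r}) (\<lambda>_. cgauss)). Re (det (gram \<rho> c r h)) < t}"
proof -
  let ?K = "{0..<r} \<times> {0..<c}" and ?I = "{0..<c} \<times> {0..<r}"
  let ?P = "PiM ?K (\<lambda>_. cgauss)" and ?Q = "PiM ?I (\<lambda>_. cgauss)"
  let ?s = "\<lambda>h. \<lambda>p\<in>?I. h (prod.swap p) :: complex"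
  let ?B = "{h \<in> space ?Q. Re (det (gram \<rho> c r h)) < t}"
  have distr: "distr ?P ?Q ?s = ?Q"
    by (rule distr_PiM_reindex[where M = "\<lambda>_. cgauss"]) (auto simp: prob_space_cgauss)
  have s: "?s \<in> measurable ?P ?Q"
    by (intro measurable_restrict measurable_component_singleton) auto
  have "det (gram \<rho> c r (?s h)) = det (gram \<rho> r c h)" for h
  proof -
    have "gram \<rho> c r (?s h) = gram \<rho> c r (\<lambda>(i, j). h (j, i))" by (rule gram_cong) auto
    then show ?thesis by (simp add: det_gram_swap[of \<rho> r c])
  qed
  then have "{h \<in> space ?P. Re (det (gram \<rho> r c h)) < t} = ?s -` ?B \<inter> space ?P"
    using measurable_space[OF s] by auto
  then have "measure ?P {h \<in> space ?P. Re (det (gram \<rho> r c h)) < t} = measure (distr ?P ?Q ?s) ?B"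
    using s by (simp add: measure_distr borel_measurable_less[OF borel_measurable_det_gram_PiM])
  then show ?thesis unfolding distr .
qed

text \<open>Positivity of the determinant lets the logarithmic inequality be exponentiated;
  transposition then puts the shorter dimension on the rows.\<close>

lemma P_out_ZF_eq:
  assumes "0 < \<eta>" "0 < g"
  shows "P_out_ZF Nt Nm Ne \<eta> g rs =
    (let n = Nt - Ne; m = min n Nm; k = max n Nm; P = PiM ({0..<m} \<times> {0..<k}) (\<lambda>_. cgauss) in
      measure P {h \<in> space P. Re (det (gram (\<eta> / real n) m k h)) < (1 + g * \<eta>) powr rs})"
proof -
  define n where "n = Nt - Ne"
  let ?P = "PiM ({0..<Nm} \<times> {0..<n}) (\<lambda>_. cgauss)"
  have "ln (Re (det (gram (\<eta> / real n) Nm n h))) < rs * ln (1 + g * \<eta>) \<longleftrightarrow>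
      Re (det (gram (\<eta> / real n) Nm n h)) < (1 + g * \<eta>) powr rs" for h
  proof -
    have "0 < Re (det (gram (\<eta> / real n) Nm n h))" using assms by (intro det_gram_pos) simp
    moreover have "0 < 1 + g * \<eta>" using assms by (simp add: add_pos_pos)
    ultimately show ?thesis
      using exp_less_cancel_iff[of "ln (Re (det (gram (\<eta> / real n) Nm n h)))" "rs * ln (1 + g * \<eta>)"]
      by (simp add: powr_def)
  qed
  then have "P_out_ZF Nt Nm Ne \<eta> g rs =
      measure ?P {h \<in> space ?P. Re (det (gram (\<eta> / real n) Nm n h)) < (1 + g * \<eta>) powr rs}"
    unfolding P_out_ZF_def Let_def n_def[symmetric] gram_eq_one_plus gauss_mat_law_def by simp
  then show ?thesis
    unfolding Let_def n_def[symmetric]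
    by (cases "Nm \<le> n") (simp_all add: min_def max_def measure_det_gram_swap[of Nm n])
qed

theorem theorem1:
  fixes Nt Nm Ne :: nat and \<eta> g rs :: real and b :: "nat \<Rightarrow> real"
  assumes "0 < Nt" "0 < Nm" "0 < Ne" "Ne < Nt"
    and "0 < \<eta>" "0 < g" "0 < rs"
    and "\<forall>l\<in>{1..min (Nt - Ne) Nm}. 0 < b l"
    and "\<forall>l\<in>{1..<min (Nt - Ne) Nm}. b (Suc l) \<le> b l"
    and "(\<Sum>l=1..min (Nt - Ne) Nm. b l) = rs"
  shows "P_out_ZF Nt Nm Ne \<eta> g rs \<le>
    (let n = Nt - Ne; m = min n Nm; k = max n Nm in
      (\<Prod>l=1..m. Gamma_inc (xi n \<eta> g rs) (k - l + 1)) *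
      (1 - (\<Prod>l=1..m. 1 - Gamma_inc (xi n \<eta> g (b l)) (k - l + 1)
                           / Gamma_inc (xi n \<eta> g rs) (k - l + 1))))"
proof -
  define n m k where "n = Nt - Ne" and "m = min n Nm" and "k = max n Nm"
  define d where "d = k - m"
  define \<rho> where "\<rho> = \<eta> / real n"
  define q where "q = 1 + g * \<eta>"
  define \<xi> where "\<xi> = xi n \<eta> g"
  have k: "k = m + d" by (auto simp: d_def m_def k_def)
  have n: "0 < n" using assms(4) by (simp add: n_def)
  have \<rho>: "0 < \<rho>" using assms(5) n by (simp add: \<rho>_def)
  have q: "1 < q" using assms(5,6) by (simp add: q_def)
  have b: "0 < b l" if "l \<in> {1..m}" for l using assms(8) that by (auto simp: m_def n_def)
  have sum_b: "(\<Sum>l=1..m. b l) = rs" using assms(10) by (simp add: m_def n_def)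
  have b_le: "b l \<le> rs" if "l \<in> {1..m}" for l
    unfolding sum_b[symmetric] using that b by (intro member_le_sum) (auto intro: less_imp_le)
  \<comment> \<open>The thresholds \<open>\<xi>\<close> are made for this identity: it turns the sum
    of the \<open>b l\<close> into a product of factors.\<close>
  have \<xi>: "1 + \<rho> * \<xi> x = q powr x" for x
    using assms(5) n by (simp add: \<xi>_def xi_def \<rho>_def q_def)
  have \<xi>_mono: "\<xi> x \<le> \<xi> y" if "x \<le> y" for x y
  proof -
    have "q powr x \<le> q powr y" using that q by (simp add: powr_mono)
    then show ?thesis unfolding \<xi>[symmetric] using \<rho> by simp
  qed
  have "\<rho> * \<xi> 0 = 0" using \<xi>[of 0] q by simp
  then have \<xi>0: "\<xi> 0 = 0" using \<rho> by simp
  have \<xi>_bounds: "0 \<le> \<xi> (b l)" "\<xi> (b l) \<le> \<xi> rs" if "l \<in> {1..m}" for l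
    using \<xi>_mono[of 0 "b l"] \<xi>_mono[of "b l" rs] b[OF that] b_le[OF that] \<xi>0 by auto
  \<comment> \<open>The comparison variables are numbered from \<open>0\<close> with shapes rising
    from \<open>d + 1\<close>, the statement from \<open>1\<close> with shapes falling from
    \<open>k\<close>; \<open>l\<close> corresponds to \<open>m - l\<close>.\<close>
  have rev: "(\<Prod>l<m. f (m - l)) = (\<Prod>l=1..m. f l)" for f :: "nat \<Rightarrow> real"
    by (rule prod.reindex_bij_witness[of _ "\<lambda>l. m - l" "\<lambda>l. m - l"]) auto
  define A where "A l = Gamma_inc (\<xi> rs) (k - l + 1)" for l
  define C where "C l = Gamma_inc (\<xi> (b l)) (k - l + 1)" for l
  have idx: "Suc (d + l) = k - (m - l) + 1" if "l < m" for l using that k by simp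
  have prod_powr: "(\<Prod>l=1..m. q powr b l) = q powr (\<Sum>l=1..m. b l)"
    using q by (simp add: powr_sum)
  have "(\<Prod>l<m. 1 + \<rho> * \<xi> (b (m - l))) = q powr rs"
    unfolding \<xi> rev[of "\<lambda>l. q powr b l"] prod_powr sum_b ..
  then have bound: "measure (PiM {0..<m} (\<lambda>l. erlang_measure (d + l)))
      {x \<in> space (PiM {0..<m} (\<lambda>l. erlang_measure (d + l))). (\<Prod>l<m. 1 + \<rho> * x l) < q powr rs} \<le>
    (\<Prod>l<m. Gamma_inc (\<xi> rs) (Suc (d + l))) -
    (\<Prod>l<m. Gamma_inc (\<xi> rs) (Suc (d + l)) - Gamma_inc (\<xi> (b (m - l))) (Suc (d + l)))"
    using \<rho> \<xi>_bounds \<xi>_mono[of 0 rs] \<xi>0 assms(7)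
    by (intro measure_erlang_prod_less_le) (auto simp: \<xi>)
  have AC: "0 \<le> C l" "C l \<le> A l" if "l \<in> {1..m}" for l
    using Gamma_inc_mono[OF \<xi>_bounds[OF that], of "k - l"] by (simp_all add: A_def C_def)
  let ?P = "PiM ({0..<m} \<times> {0..<m + d}) (\<lambda>_. cgauss)"
  let ?S = "PiM {0..<m} (\<lambda>l. erlang_measure (d + l))"
  interpret P: prob_space ?P by (rule prob_space_PiM) (rule prob_space_cgauss)
  interpret S: prob_space ?S by (rule prob_space_PiM) (rule prob_space_erlang_density, simp)
  have "P_out_ZF Nt Nm Ne \<eta> g rs = measure ?P {h \<in> space ?P. Re (det (gram \<rho> m (m + d) h)) < q powr rs}"
    unfolding P_out_ZF_eq[OF assms(5,6)] Let_def n_def[symmetric] m_def[symmetric] k_def[symmetric] k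
      \<rho>_def q_def ..
  also have "\<dots> \<le> measure ?S {x \<in> space ?S. (\<Prod>l<m. 1 + \<rho> * x l) < q powr rs}"
    using emeasure_det_gram_less_le[of \<rho> m d "q powr rs"] \<rho>
    unfolding P.emeasure_eq_measure S.emeasure_eq_measure by simp
  also note bound
  also have "(\<Prod>l<m. Gamma_inc (\<xi> rs) (Suc (d + l))) = (\<Prod>l<m. A (m - l))"
    by (intro prod.cong refl) (simp add: A_def idx)
  also have "\<dots> = (\<Prod>l=1..m. A l)" by (rule rev)
  also have "(\<Prod>l<m. Gamma_inc (\<xi> rs) (Suc (d + l)) - Gamma_inc (\<xi> (b (m - l))) (Suc (d + l))) =
      (\<Prod>l<m. A (m - l) - C (m - l))"
    by (intro prod.cong refl) (simp add: A_def C_def idx)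
  also have "\<dots> = (\<Prod>l=1..m. A l - C l)" by (rule rev)
  also have "\<dots> = (\<Prod>l=1..m. A l * (1 - C l / A l))"
  proof (rule prod.cong[OF refl])
    fix l assume "l \<in> {1..m}"
    from AC[OF this] show "A l - C l = A l * (1 - C l / A l)"
      \<comment> \<open>If \<open>A l = 0\<close>, then \<open>AC\<close> gives
        \<open>C l = 0\<close> and both sides vanish.\<close>
      by (cases "A l = 0") (auto simp: field_simps)
  qed
  also have "(\<Prod>l=1..m. A l) - (\<Prod>l=1..m. A l * (1 - C l / A l)) =
      (\<Prod>l=1..m. A l) * (1 - (\<Prod>l=1..m. 1 - C l / A l))"
    unfolding prod.distrib by (simp only: right_diff_distrib mult_1_right)
  finally show ?thesis
    unfolding Let_def n_def[symmetric] m_def[symmetric] k_def[symmetric] A_def C_def \<xi>_def .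
qed

end
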